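(* Fix data $\mathbf{v}=(\mathbf{v}^{\mathrm{Re}},\mathbf{v}^{\mathrm{Im}})\in\mathbb{R}^{2N}$ and $\mathbf{y}_k\in\mathbb{R}^{2|\mathcal{N}_k|}$, $k\in\mathcal{N}$, and, for every bus $k\in\mathcal{N}$, let $(\mathbf{z}_k^{(m)},\mathbf{u}_k^{(m)})_{m\ge 1}$ be the iterates of Algorithm 2 (defined in the context) with input $(\mathbf{v},\mathbf{y}_k)$, run without stopping. Suppose that for every $k\in\mathcal{N}$ there exists $(\mathbf{z}_k^\star,\mathbf{u}_k^\star)$ with $$\lim_{m\to\infty}(\mathbf{z}_k^{(m)},\mathbf{u}_k^{(m)})=(\mathbf{z}_k^\star,\mathbf{u}_k^\star),$$ and that the components $(\mathbf{v}_k^{\mathrm{Re}},\mathbf{v}_k^{\mathrm{Im}})$ of $\mathbf{z}_k^\star$ strictly satisfy the constraints $((\mathbf{v}_k^{\mathrm{Re}})_r,(\mathbf{v}_k^{\mathrm{Im}})_r)\in\check{\mathcal{X}}^k_r$, $r=1,\dots,|\mathcal{N}_k|$ (i.e. all inequalities describing $\check{\mathcal{X}}^k_r$ hold strictly). Then, for every $k\in\mathcal{N}$, the output $(\mathbf{z}_k^\star,\mathbf{u}_k^\star)$ of Algorithm 2 satisfies the Karush-Kuhn-Tucker (KKT) conditions of the nonconvex subproblem $(\mathrm{P}_k)$ defined in the context.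
   Context: **Network.** $\mathcal{N}=\{1,\dots,N\}$ is the set of buses, $\mathcal{L}\subseteq\mathcal{N}\times\mathcal{N}$ the set of flow lines, $\mathcal{G}\subseteq\mathcal{N}$ the set of generator buses. The admittance matrix $\mathbf{Y}\in\mathbb{C}^{N\times N}$ has entries $y_{ll}+\sum_{(l,t)\in\mathcal{L}}y_{lt}$ if $l=s$, $-y_{ls}$ if $(l,s)\in\mathcal{L}$, and $0$ otherwise, where $y_{ls}\in\mathbb{C}$ are given line admittances and $y_{ll}\in\mathbb{C}$ given admittances to ground; $\mathbf{G}=\mathrm{Re}\,\mathbf{Y}$, $\mathbf{B}=\mathrm{Im}\,\mathbf{Y}$. For $k\in\mathcal{N}$, $\mathcal{N}_k=\{k\}\cup\{n:(k,n)\in\mathcal{L}\}$, listed in a fixed order with $k$ first. $\mathbf{E}_k\in\{0,1\}^{|\mathcal{N}_k|\times N}$ is the selection matrix with $(\mathbf{E}_k)_{ls}=1$ iff $s$ is the $l$-th element of $\mathcal{N}_k$; $\bar{\mathbf{E}}_k=\mathrm{diag}(\mathbf{E}_k,\mathbf{E}_k)$ (block diagonal). $\mathbf{g}_k$ (resp. $\mathbf{b}_k$) is the $k$-th column of $\mathbf{G}$ (resp. $\mathbf{B}$) restricted to the rows in $\mathcal{N}_k$, in the same order. $\mathbf{C}_k\in\mathbb{R}^{(|\mathcal{N}_k|-1)\times|\mathcal{N}_k|}$ has $r$-th row with first entry $(\mathbf{g}_k)_{r+1}$, $(r+1)$-th entry $-(\mathbf{g}_k)_{r+1}$ and all other entries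 $0$; $\mathbf{D}_k$ is defined in the same way with $\mathbf{b}_k$ in place of $\mathbf{g}_k$. **Local variables of bus $k$.** $$\mathbf{z}_k=(p_k^{G},q_k^{G},p_k,q_k,i_k^{\mathrm{Re}},i_k^{\mathrm{Im}},\mathbf{v}_k^{\mathrm{Re}},\mathbf{v}_k^{\mathrm{Im}},\bar{\mathbf{i}}_k^{\mathrm{Re}},\bar{\mathbf{i}}_k^{\mathrm{Im}},\bar{\mathbf{p}}_k,\bar{\mathbf{q}}_k),$$ with the first six entries in $\mathbb{R}$, $\mathbf{v}_k^{\mathrm{Re}},\mathbf{v}_k^{\mathrm{Im}}\in\mathbb{R}^{|\mathcal{N}_k|}$ and the last four blocks in $\mathbb{R}^{|\mathcal{N}_k|-1}$. Write $\mathbf{v}_k=(\mathbf{v}_k^{\mathrm{Re}},\mathbf{v}_k^{\mathrm{Im}})$. **Constraints** ($j=\sqrt{-1}$; demands $p_k^D,q_k^D$ and all bounds are given real data, with $(\mathbf{v}_k^{\min})_r,(\mathbf{v}_k^{\max})_r\ge 0$ being voltage magnitude bounds): - $\boldsymbol{\alpha}_k(\mathbf{z}_k)=0$ (affine): $i_k^{\mathrm{Re}}+j i_k^{\mathrm{Im}}=\mathbf{g}_k^T\mathbf{v}_k^{\mathrm{Re}}-\mathbf{b}_k^T\mathbf{v}_k^{\mathrm{Im}}+j(\mathbf{b}_k^T\mathbf{v}_k^{\mathrm{Re}}+\mathbf{g}_k^T\mathbf{v}_k^{\mathrm{Im}})$; $p_k+jq_k=p_k^G-p_k^D+j(q_k^G-q_k^D)$;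 $\bar{\mathbf{i}}_k^{\mathrm{Re}}+j\bar{\mathbf{i}}_k^{\mathrm{Im}}=\mathbf{C}_k\mathbf{v}_k^{\mathrm{Re}}+\mathbf{D}_k\mathbf{v}_k^{\mathrm{Im}}+j(\mathbf{D}_k\mathbf{v}_k^{\mathrm{Re}}-\mathbf{C}_k\mathbf{v}_k^{\mathrm{Im}})$. - $\boldsymbol{\lambda}_k(\mathbf{z}_k)=0$: $p_k-(\mathbf{v}_k^{\mathrm{Re}})_1 i_k^{\mathrm{Re}}-(\mathbf{v}_k^{\mathrm{Im}})_1 i_k^{\mathrm{Im}}=0$ and $q_k-(\mathbf{v}_k^{\mathrm{Im}})_1 i_k^{\mathrm{Re}}+(\mathbf{v}_k^{\mathrm{Re}})_1 i_k^{\mathrm{Im}}=0$. - $\boldsymbol{\mu}_k(\mathbf{z}_k)=0$: $\bar{\mathbf{p}}_k-(\mathbf{v}_k^{\mathrm{Re}})_1\bar{\mathbf{i}}_k^{\mathrm{Re}}-(\mathbf{v}_k^{\mathrm{Im}})_1\bar{\mathbf{i}}_k^{\mathrm{Im}}=0$ and $\bar{\mathbf{q}}_k-(\mathbf{v}_k^{\mathrm{Im}})_1\bar{\mathbf{i}}_k^{\mathrm{Re}}+(\mathbf{v}_k^{\mathrm{Re}})_1\bar{\mathbf{i}}_k^{\mathrm{Im}}=0$. - $\boldsymbol{\beta}_k(\mathbf{z}_k)\le 0$ (linear inequalities): $p_k^{G,\min}\le p_k^G\le p_k^{G,\max}$, $q_k^{G,\min}\le q_k^G\le q_k^{G,\max}$,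 $-(\bar{\mathbf{p}}_k^{\max})_r\le(\bar{\mathbf{p}}_k)_r\le(\bar{\mathbf{p}}_k^{\max})_r$, $r=1,\dots,|\mathcal{N}_k|-1$. For $k\notin\mathcal{G}$ the four generation bounds are $0$. - $\boldsymbol{\gamma}_k(\mathbf{z}_k)\le 0$: $(\bar{\mathbf{i}}_k^{\mathrm{Re}})_r^2+(\bar{\mathbf{i}}_k^{\mathrm{Im}})_r^2\le(\bar{\mathbf{i}}_k^{\max})_r^2$ and $(\bar{\mathbf{p}}_k)_r^2+(\bar{\mathbf{q}}_k)_r^2\le(\bar{\mathbf{s}}_k^{\max})_r^2$, $r=1,\dots,|\mathcal{N}_k|-1$. - Voltage constraints: $(\mathbf{v}_k^{\min})_r^2\le(\mathbf{v}_k^{\mathrm{Re}})_r^2+(\mathbf{v}_k^{\mathrm{Im}})_r^2\le(\mathbf{v}_k^{\max})_r^2$, $r=1,\dots,|\mathcal{N}_k|$; the set of pairs in $\mathbb{R}^2$ satisfying the $r$-th one is denoted $\mathcal{X}^k_r$. **Subproblem $(\mathrm{P}_k)$.** Given $\mathbf{v}$, $\mathbf{y}_k$ and $\rho>0$, minimize over $\mathbf{z}_k$ $$f_k^G(p_k^G)+\mathbf{y}_k^T(\mathbf{v}_k-\bar{\mathbf{E}}_k\mathbf{v})+\tfrac{\rho}{2}\|\mathbf{v}_k-\bar{\mathbf{E}}_k\mathbf{v}\|_2^2$$ subject to $\boldsymbol{\alpha}_k=0$, $\boldsymbol{\lambda}_k=0$, $\boldsymbol{\mu}_k=0$, $\boldsymbol{\beta}_k\le0$,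 $\boldsymbol{\gamma}_k\le0$ and the voltage constraints. Here $f_k^G:\mathbb{R}\to\mathbb{R}$ is a differentiable convex cost function ($f_k^G\equiv0$ for $k\notin\mathcal{G}$). **Sets $\check{\mathcal{X}}^k_r$.** Given a point $(\check x,\check y)=((\check{\mathbf{v}}_k^{\mathrm{Re}})_r,(\check{\mathbf{v}}_k^{\mathrm{Im}})_r)$, $\check{\mathcal{X}}^k_r$ is the intersection of $\mathcal{X}^k_r$ with the halfspace $\{(x,y)\in\mathbb{R}^2: a_rx+b_ry\ge c_r\}$, where, if $\check x\neq0$, $a_r=\mathrm{sign}(\check x)\sqrt{(\mathbf{v}_k^{\min})_r^2/(1+(\check y/\check x)^2)}$, $b_r=a_r\check y/\check x$, $c_r=(\mathbf{v}_k^{\min})_r^2$; and, if $\check x=0$, $a_r=0$, $b_r=\mathrm{sign}(\check y)$, $c_r=(\mathbf{v}_k^{\min})_r$. As a constraint, $(x,y)\in\check{\mathcal{X}}^k_r$ is expressed by the two inequalities $c_r\le a_rx+b_ry$ and $x^2+y^2\le(\mathbf{v}_k^{\max})_r^2$. **Algorithm 2** (input $\mathbf{v},\mathbf{y}_k$). (1) For all $r$ set $((\check{\mathbf{v}}_k^{\mathrm{Re}})_r,(\check{\mathbf{v}}_k^{\mathrm{Im}})_r)=((\mathbf{E}_k\mathbf{v}^{\mathrm{Re}})_r,(\mathbf{E}_k\mathbf{v}^{\mathrm{Im}})_r)$ and construct $\check{\mathcal{X}}^k_r$ (kept fixed afterwards). Set $m=1$. Initialize $\hat{\mathbf{z}}_k$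 by giving its $\mathbf{v}_k$-component the value $(\check{\mathbf{v}}_k^{\mathrm{Re}},\check{\mathbf{v}}_k^{\mathrm{Im}})$ and determining the other components from $\boldsymbol{\alpha}_k=0,\boldsymbol{\lambda}_k=0,\boldsymbol{\mu}_k=0$. (2) Solve the convex problem obtained from $(\mathrm{P}_k)$ by replacing $\boldsymbol{\lambda}_k,\boldsymbol{\mu}_k$ by their first-order Taylor approximations $\hat{\boldsymbol{\lambda}}_k^{\hat{\mathbf{z}}_k},\hat{\boldsymbol{\mu}}_k^{\hat{\mathbf{z}}_k}$ at $\hat{\mathbf{z}}_k$ and the voltage constraints by $((\mathbf{v}_k^{\mathrm{Re}})_r,(\mathbf{v}_k^{\mathrm{Im}})_r)\in\check{\mathcal{X}}^k_r$, $r=1,\dots,|\mathcal{N}_k|$; $\mathbf{z}_k^{(m)}$ denotes the optimal solution and $\mathbf{u}_k^{(m)}$ the collection of all dual optimal variables. (3) Set $\hat{\mathbf{z}}_k=\mathbf{z}_k^{(m)}$, $m:=m+1$, and go to (2). **KKT conditions and identification of multipliers.** The KKT conditions of $(\mathrm{P}_k)$ are: primal feasibility, nonnegativity of the multipliers of inequality constraints, complementary slackness, and vanishing of the gradient in $\mathbf{z}_k$ of the Lagrangian. The entries of $\mathbf{u}_k^\star$ are used as multipliers for the corresponding constraints of $(\mathrm{P}_k)$: those of $\hat{\boldsymbol{\lambda}}_k,\hat{\boldsymbol{\mu}}_k$ for $\boldsymbol{\lambda}_k,\boldsymbol{\mu}_k$; that of $c_r\le a_rx+b_ry$ for the lower voltage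 bound $(\mathbf{v}_k^{\min})_r^2\le(\mathbf{v}_k^{\mathrm{Re}})_r^2+(\mathbf{v}_k^{\mathrm{Im}})_r^2$; that of $x^2+y^2\le(\mathbf{v}_k^{\max})_r^2$ for the upper voltage bound; the remaining constraints are identical in the two problems. *)

theory Defs
  imports "HOL-Analysis.Analysis" "Jordan_Normal_Form.Matrix"
begin

(* Vectors and matrices are those of Jordan_Normal_Form, because the dimensions depend on the
   bus k; the clashing notation of HOL-Analysis is switched off. *)
no_notation inner (infix \<open>\<bullet>\<close> 70)
no_notation Finite_Cartesian_Product.vec_nth (infixl \<open>$\<close> 90)
hide_type (open) Finite_Cartesian_Product.vec
hide_const (open) Finite_Cartesian_Product.vec Finite_Cartesian_Product.mat

section \<open>Gradients and first-order Taylor approximations\<close>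

definition gradient :: "nat \<Rightarrow> (real vec \<Rightarrow> real) \<Rightarrow> real vec \<Rightarrow> real vec" where
  "gradient d F z = vec d (\<lambda>i. deriv (\<lambda>t. F (update_vec z i t)) (z $ i))"

definition taylor1 :: "nat \<Rightarrow> (real vec \<Rightarrow> real vec) \<Rightarrow> real vec \<Rightarrow> real vec \<Rightarrow> real vec" where
  "taylor1 d F a z = vec (dim_vec (F a)) (\<lambda>i. F a $ i + gradient d (\<lambda>w. F w $ i) a \<bullet> (z - a))"

definition vec_tendsto :: "(nat \<Rightarrow> real vec) \<Rightarrow> real vec \<Rightarrow> bool" where
  "vec_tendsto X x \<longleftrightarrow>
     (\<forall>\<^sub>F m in sequentially. dim_vec (X m) = dim_vec x) \<and>
     (\<forall>i<dim_vec x. (\<lambda>m. X m $ i) \<longlonglongrightarrow> x $ i)"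

section \<open>Nonlinear programs, Lagrangian duality and KKT conditions\<close>

(* minimize objective z over z in R^n_var subject to eq_con z = 0 (n_eq components) and
   ineq_con z \<le> 0 (n_ineq components) *)
record nlp =
  n_var :: nat
  n_eq :: nat
  n_ineq :: nat
  objective :: "real vec \<Rightarrow> real"
  eq_con :: "real vec \<Rightarrow> real vec"
  ineq_con :: "real vec \<Rightarrow> real vec"

(* the multipliers of the equality and of the inequality constraints *)
type_synonym multipliers = "real vec \<times> real vec"

definition feasible :: "nlp \<Rightarrow> real vec \<Rightarrow> bool" where
  "feasible P z \<longleftrightarrow> z \<in> carrier_vec (n_var P) \<and>
     eq_con P z = 0\<^sub>v (n_eq P) \<and> ineq_con P z \<le> 0\<^sub>v (n_ineq P)"

definition optimal_solution :: "nlp \<Rightarrow> real vec \<Rightarrow> bool" where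
  "optimal_solution P z \<longleftrightarrow> feasible P z \<and> (\<forall>z'. feasible P z' \<longrightarrow> objective P z \<le> objective P z')"

definition lagrangian :: "nlp \<Rightarrow> multipliers \<Rightarrow> real vec \<Rightarrow> real" where
  "lagrangian P u z = objective P z + fst u \<bullet> eq_con P z + snd u \<bullet> ineq_con P z"

definition dual_feasible :: "nlp \<Rightarrow> multipliers \<Rightarrow> bool" where
  "dual_feasible P u \<longleftrightarrow> fst u \<in> carrier_vec (n_eq P) \<and> snd u \<in> carrier_vec (n_ineq P) \<and>
     0\<^sub>v (n_ineq P) \<le> snd u"

definition dual_function :: "nlp \<Rightarrow> multipliers \<Rightarrow> ereal" where
  "dual_function P u = (INF z\<in>carrier_vec (n_var P). ereal (lagrangian P u z))"

definition dual_optimal :: "nlp \<Rightarrow> multipliers \<Rightarrow> bool" where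
  "dual_optimal P u \<longleftrightarrow> dual_feasible P u \<and>
     (\<forall>u'. dual_feasible P u' \<longrightarrow> dual_function P u' \<le> dual_function P u)"

definition kkt :: "nlp \<Rightarrow> real vec \<Rightarrow> multipliers \<Rightarrow> bool" where
  "kkt P z u \<longleftrightarrow> feasible P z \<and> dual_feasible P u \<and>
     (\<forall>i<n_ineq P. snd u $ i * ineq_con P z $ i = 0) \<and>
     gradient (n_var P) (lagrangian P u) z = 0\<^sub>v (n_var P)"

section \<open>Network data\<close>

(* Buses are 0, ..., nbus - 1, matching the indices of matrices and vectors.  For l \<noteq> s, adm l s is
   the admittance of the line (l, s), and adm l l is the admittance of bus l to ground. *)
record network =
  nbus :: nat
  lines :: "(nat \<times> nat) set"
  gens :: "nat set"
  adm :: "nat \<Rightarrow> nat \<Rightarrow> complex"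
  nbrs :: "nat \<Rightarrow> nat list"
  pD :: "nat \<Rightarrow> real"
  qD :: "nat \<Rightarrow> real"
  pGmin :: "nat \<Rightarrow> real"
  pGmax :: "nat \<Rightarrow> real"
  qGmin :: "nat \<Rightarrow> real"
  qGmax :: "nat \<Rightarrow> real"
  pbar_max :: "nat \<Rightarrow> real vec"
  ibar_max :: "nat \<Rightarrow> real vec"
  sbar_max :: "nat \<Rightarrow> real vec"
  vmin :: "nat \<Rightarrow> real vec"
  vmax :: "nat \<Rightarrow> real vec"
  cost :: "nat \<Rightarrow> real \<Rightarrow> real"

(* the cardinality of N_k *)
definition nk :: "network \<Rightarrow> nat \<Rightarrow> nat" where
  "nk net k = length (nbrs net k)"

definition valid_network :: "network \<Rightarrow> bool" where
  "valid_network net \<longleftrightarrow>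
     lines net \<subseteq> {..<nbus net} \<times> {..<nbus net} \<and> gens net \<subseteq> {..<nbus net} \<and>
     (\<forall>k<nbus net.
        nbrs net k \<noteq> [] \<and> hd (nbrs net k) = k \<and> distinct (nbrs net k) \<and>
        set (nbrs net k) = {k} \<union> {n. (k, n) \<in> lines net} \<and>
        pbar_max net k \<in> carrier_vec (nk net k - 1) \<and>
        ibar_max net k \<in> carrier_vec (nk net k - 1) \<and>
        sbar_max net k \<in> carrier_vec (nk net k - 1) \<and>
        vmin net k \<in> carrier_vec (nk net k) \<and> 0\<^sub>v (nk net k) \<le> vmin net k \<and>
        vmax net k \<in> carrier_vec (nk net k) \<and> 0\<^sub>v (nk net k) \<le> vmax net k \<and>
        convex_on UNIV (cost net k) \<and> (\<forall>x. cost net k differentiable (at x)) \<and>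
        (k \<notin> gens net \<longrightarrow> pGmin net k = 0 \<and> pGmax net k = 0 \<and> qGmin net k = 0 \<and> qGmax net k = 0 \<and>
           cost net k = (\<lambda>_. 0)))"

definition Y_mat :: "network \<Rightarrow> complex mat" where
  "Y_mat net = mat (nbus net) (nbus net) (\<lambda>(l, s).
     if l = s then adm net l l + (\<Sum>t\<in>{t. (l, t) \<in> lines net}. adm net l t)
     else if (l, s) \<in> lines net then - adm net l s else 0)"

definition G_mat :: "network \<Rightarrow> real mat" where
  "G_mat net = map_mat Re (Y_mat net)"

definition B_mat :: "network \<Rightarrow> real mat" where
  "B_mat net = map_mat Im (Y_mat net)"

definition E_mat :: "network \<Rightarrow> nat \<Rightarrow> real mat" where
  "E_mat net k = mat (nk net k) (nbus net) (\<lambda>(l, s). if nbrs net k ! l = s then 1 else 0)"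

definition Ebar_mat :: "network \<Rightarrow> nat \<Rightarrow> real mat" where
  "Ebar_mat net k = four_block_mat (E_mat net k) (0\<^sub>m (nk net k) (nbus net))
                                   (0\<^sub>m (nk net k) (nbus net)) (E_mat net k)"

definition g_vec :: "network \<Rightarrow> nat \<Rightarrow> real vec" where
  "g_vec net k = vec (nk net k) (\<lambda>r. G_mat net $$ (nbrs net k ! r, k))"

definition b_vec :: "network \<Rightarrow> nat \<Rightarrow> real vec" where
  "b_vec net k = vec (nk net k) (\<lambda>r. B_mat net $$ (nbrs net k ! r, k))"

definition diff_mat :: "real vec \<Rightarrow> real mat" where
  "diff_mat g = mat (dim_vec g - 1) (dim_vec g) (\<lambda>(r, s).
     if s = 0 then g $ (r + 1) else if s = r + 1 then - g $ (r + 1) else 0)"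

definition C_mat :: "network \<Rightarrow> nat \<Rightarrow> real mat" where
  "C_mat net k = diff_mat (g_vec net k)"

definition D_mat :: "network \<Rightarrow> nat \<Rightarrow> real mat" where
  "D_mat net k = diff_mat (b_vec net k)"

section \<open>Local variables\<close>

(* z_k is the stacked vector
     (pG, qG, p, q, iRe, iIm, vRe, vIm, ibRe, ibIm, pb, qb)
   with blocks of dimensions 1, 1, 1, 1, 1, 1, n, n, n - 1, n - 1, n - 1, n - 1 where
   n = nk net k is the first argument of the block projections. *)
definition zdim :: "nat \<Rightarrow> nat" where
  "zdim n = 6 + 2 * n + 4 * (n - 1)"

definition block :: "real vec \<Rightarrow> nat \<Rightarrow> nat \<Rightarrow> real vec" where
  "block z off len = vec len (\<lambda>r. z $ (off + r))"

definition pG :: "real vec \<Rightarrow> real" where "pG z = z $ 0"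
definition qG :: "real vec \<Rightarrow> real" where "qG z = z $ 1"
definition p_inj :: "real vec \<Rightarrow> real" where "p_inj z = z $ 2"
definition q_inj :: "real vec \<Rightarrow> real" where "q_inj z = z $ 3"
definition iRe :: "real vec \<Rightarrow> real" where "iRe z = z $ 4"
definition iIm :: "real vec \<Rightarrow> real" where "iIm z = z $ 5"
definition vRe :: "nat \<Rightarrow> real vec \<Rightarrow> real vec" where "vRe n z = block z 6 n"
definition vIm :: "nat \<Rightarrow> real vec \<Rightarrow> real vec" where "vIm n z = block z (6 + n) n"
definition ibRe :: "nat \<Rightarrow> real vec \<Rightarrow> real vec" where
  "ibRe n z = block z (6 + 2 * n) (n - 1)"
definition ibIm :: "nat \<Rightarrow> real vec \<Rightarrow> real vec" where
  "ibIm n z = block z (6 + 2 * n + (n - 1)) (n - 1)"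
definition pb :: "nat \<Rightarrow> real vec \<Rightarrow> real vec" where
  "pb n z = block z (6 + 2 * n + 2 * (n - 1)) (n - 1)"
definition qb :: "nat \<Rightarrow> real vec \<Rightarrow> real vec" where
  "qb n z = block z (6 + 2 * n + 3 * (n - 1)) (n - 1)"

definition v_loc :: "nat \<Rightarrow> real vec \<Rightarrow> real vec" where
  "v_loc n z = vRe n z @\<^sub>v vIm n z"

section \<open>Constraints\<close>

definition alpha_con :: "network \<Rightarrow> nat \<Rightarrow> real vec \<Rightarrow> real vec" where
  "alpha_con net k z = (let n = nk net k; g = g_vec net k; b = b_vec net k; C = C_mat net k; D = D_mat net k in
     vec_of_list
       [iRe z - (g \<bullet> vRe n z - b \<bullet> vIm n z),
        iIm z - (b \<bullet> vRe n z + g \<bullet> vIm n z),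
        p_inj z - (pG z - pD net k),
        q_inj z - (qG z - qD net k)]
     @\<^sub>v (ibRe n z - (C *\<^sub>v vRe n z + D *\<^sub>v vIm n z))
     @\<^sub>v (ibIm n z - (D *\<^sub>v vRe n z - C *\<^sub>v vIm n z)))"

definition lambda_con :: "network \<Rightarrow> nat \<Rightarrow> real vec \<Rightarrow> real vec" where
  "lambda_con net k z = (let n = nk net k in
     vec_of_list
       [p_inj z - vRe n z $ 0 * iRe z - vIm n z $ 0 * iIm z,
        q_inj z - vIm n z $ 0 * iRe z + vRe n z $ 0 * iIm z])"

definition mu_con :: "network \<Rightarrow> nat \<Rightarrow> real vec \<Rightarrow> real vec" where
  "mu_con net k z = (let n = nk net k in
     (pb n z - vRe n z $ 0 \<cdot>\<^sub>v ibRe n z - vIm n z $ 0 \<cdot>\<^sub>v ibIm n z)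
     @\<^sub>v (qb n z - vIm n z $ 0 \<cdot>\<^sub>v ibRe n z + vRe n z $ 0 \<cdot>\<^sub>v ibIm n z))"

definition beta_con :: "network \<Rightarrow> nat \<Rightarrow> real vec \<Rightarrow> real vec" where
  "beta_con net k z = (let n = nk net k in
     vec_of_list
       [pGmin net k - pG z, pG z - pGmax net k,
        qGmin net k - qG z, qG z - qGmax net k]
     @\<^sub>v (- pbar_max net k - pb n z)
     @\<^sub>v (pb n z - pbar_max net k))"

definition gamma_con :: "network \<Rightarrow> nat \<Rightarrow> real vec \<Rightarrow> real vec" where
  "gamma_con net k z = (let n = nk net k in
     vec (n - 1) (\<lambda>r. (ibRe n z $ r)\<^sup>2 + (ibIm n z $ r)\<^sup>2 - (ibar_max net k $ r)\<^sup>2)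
     @\<^sub>v vec (n - 1) (\<lambda>r. (pb n z $ r)\<^sup>2 + (qb n z $ r)\<^sup>2 - (sbar_max net k $ r)\<^sup>2))"

definition volt_lower :: "network \<Rightarrow> nat \<Rightarrow> real vec \<Rightarrow> real vec" where
  "volt_lower net k z = (let n = nk net k in
     vec n (\<lambda>r. (vmin net k $ r)\<^sup>2 - ((vRe n z $ r)\<^sup>2 + (vIm n z $ r)\<^sup>2)))"

definition volt_upper :: "network \<Rightarrow> nat \<Rightarrow> real vec \<Rightarrow> real vec" where
  "volt_upper net k z = (let n = nk net k in
     vec n (\<lambda>r. (vRe n z $ r)\<^sup>2 + (vIm n z $ r)\<^sup>2 - (vmax net k $ r)\<^sup>2))"

definition local_cost :: "network \<Rightarrow> real \<Rightarrow> nat \<Rightarrow> real vec \<Rightarrow> real vec \<Rightarrow> real vec \<Rightarrow> real" where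
  "local_cost net \<rho> k v y z = (let w = v_loc (nk net k) z - Ebar_mat net k *\<^sub>v v in
     cost net k (pG z) + y \<bullet> w + \<rho> / 2 * (w \<bullet> w))"

section \<open>The nonconvex subproblem\<close>

definition n_eq_con :: "nat \<Rightarrow> nat" where
  "n_eq_con n = (4 + 2 * (n - 1)) + 2 + 2 * (n - 1)"

definition n_ineq_con :: "nat \<Rightarrow> nat" where
  "n_ineq_con n = (4 + 2 * (n - 1)) + 2 * (n - 1) + n + n"

definition subproblem :: "network \<Rightarrow> real \<Rightarrow> nat \<Rightarrow> real vec \<Rightarrow> real vec \<Rightarrow> nlp" where
  "subproblem net \<rho> k v y =
     \<lparr> n_var = zdim (nk net k), n_eq = n_eq_con (nk net k), n_ineq = n_ineq_con (nk net k),
       objective = local_cost net \<rho> k v y,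
       eq_con = (\<lambda>z. alpha_con net k z @\<^sub>v lambda_con net k z @\<^sub>v mu_con net k z),
       ineq_con = (\<lambda>z. beta_con net k z @\<^sub>v gamma_con net k z @\<^sub>v volt_lower net k z @\<^sub>v volt_upper net k z) \<rparr>"

section \<open>The convex inner approximation and the algorithm\<close>

(* Coefficients of the halfspace a x + b y \<ge> c for the voltage bound vl and the point (xc, yc). *)
definition hs_a :: "real \<Rightarrow> real \<Rightarrow> real \<Rightarrow> real" where
  "hs_a vl xc yc = (if xc \<noteq> 0 then sgn xc * sqrt (vl\<^sup>2 / (1 + (yc / xc)\<^sup>2)) else 0)"

definition hs_b :: "real \<Rightarrow> real \<Rightarrow> real \<Rightarrow> real" where
  "hs_b vl xc yc = (if xc \<noteq> 0 then hs_a vl xc yc * yc / xc else sgn yc)"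

definition hs_c :: "real \<Rightarrow> real \<Rightarrow> real \<Rightarrow> real" where
  "hs_c vl xc yc = (if xc \<noteq> 0 then vl\<^sup>2 else vl)"

definition X_set :: "real \<Rightarrow> real \<Rightarrow> (real \<times> real) set" where
  "X_set vl vu = {(x, y). vl\<^sup>2 \<le> x\<^sup>2 + y\<^sup>2 \<and> x\<^sup>2 + y\<^sup>2 \<le> vu\<^sup>2}"

definition Xcheck_set :: "real \<Rightarrow> real \<Rightarrow> real \<Rightarrow> real \<Rightarrow> (real \<times> real) set" where
  "Xcheck_set vl vu xc yc =
     X_set vl vu \<inter> {(x, y). hs_a vl xc yc * x + hs_b vl xc yc * y \<ge> hs_c vl xc yc}"

(* Two inequalities suffice to describe the set: the lower voltage bound is implied. *)
lemma Xcheck_set_iff: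
  assumes "vl \<ge> 0"
  shows "(x, y) \<in> Xcheck_set vl vu xc yc \<longleftrightarrow>
     hs_c vl xc yc \<le> hs_a vl xc yc * x + hs_b vl xc yc * y \<and> x\<^sup>2 + y\<^sup>2 \<le> vu\<^sup>2"
proof -
  have cauchy: "(a * x + b * y)\<^sup>2 \<le> (a\<^sup>2 + b\<^sup>2) * (x\<^sup>2 + y\<^sup>2)" for a b :: real
  proof -
    have "(a\<^sup>2 + b\<^sup>2) * (x\<^sup>2 + y\<^sup>2) = (a * x + b * y)\<^sup>2 + (a * y - b * x)\<^sup>2"
      by (simp add: power2_eq_square algebra_simps)
    then show ?thesis by simp
  qed
  let ?a = "hs_a vl xc yc" and ?b = "hs_b vl xc yc"
  have lower: "vl\<^sup>2 \<le> x\<^sup>2 + y\<^sup>2" if h: "hs_c vl xc yc \<le> ?a * x + ?b * y"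
  proof (cases "xc = 0")
    case True
    have "vl \<le> sgn yc * y" using h True by (simp add: hs_a_def hs_b_def hs_c_def)
    also have "\<dots> \<le> \<bar>y\<bar>" by (auto simp: sgn_if)
    finally have "vl\<^sup>2 \<le> y\<^sup>2" using assms abs_le_square_iff[of vl y] by simp
    then show ?thesis by (simp add: add_increasing)
  next
    case False
    define t where "t = yc / xc"
    have pos: "1 + t\<^sup>2 > 0" by (simp add: add_pos_nonneg)
    have "?a = sgn xc * sqrt (vl\<^sup>2 / (1 + t\<^sup>2))"
      using False by (simp add: hs_a_def t_def)
    moreover have "(sgn xc)\<^sup>2 = 1" using False by (simp add: sgn_if)
    ultimately have "?a\<^sup>2 = vl\<^sup>2 / (1 + t\<^sup>2)"
      using pos by (simp only: power_mult_distrib real_sqrt_pow2 mult_1_left zero_le_power2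
          divide_nonneg_pos)
    moreover have "?b = ?a * t" using False by (simp add: hs_b_def t_def)
    ultimately have "?a\<^sup>2 + ?b\<^sup>2 = vl\<^sup>2 / (1 + t\<^sup>2) * (1 + t\<^sup>2)"
      by (simp only: power_mult_distrib distrib_left mult_1_right)
    then have ab: "?a\<^sup>2 + ?b\<^sup>2 = vl\<^sup>2"
      using pos by simp
    have "vl\<^sup>2 \<le> ?a * x + ?b * y" using h False by (simp add: hs_c_def)
    then have "(vl\<^sup>2)\<^sup>2 \<le> (?a * x + ?b * y)\<^sup>2" by (intro power_mono) auto
    also have "(?a * x + ?b * y)\<^sup>2 \<le> (?a\<^sup>2 + ?b\<^sup>2) * (x\<^sup>2 + y\<^sup>2)"
      by (rule cauchy)
    finally have le: "vl\<^sup>2 * vl\<^sup>2 \<le> vl\<^sup>2 * (x\<^sup>2 + y\<^sup>2)"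
      unfolding ab by (simp only: power2_eq_square[of "vl\<^sup>2"])
    show ?thesis
    proof (cases "vl = 0")
      case False
      then have "vl\<^sup>2 > 0" by simp
      then show ?thesis using le by (rule mult_left_le_imp_le[rotated])
    qed simp
  qed
  then show ?thesis by (auto simp: Xcheck_set_def X_set_def)
qed

definition vcheckRe :: "network \<Rightarrow> nat \<Rightarrow> real vec \<Rightarrow> real vec" where
  "vcheckRe net k v = E_mat net k *\<^sub>v vec_first v (nbus net)"

definition vcheckIm :: "network \<Rightarrow> nat \<Rightarrow> real vec \<Rightarrow> real vec" where
  "vcheckIm net k v = E_mat net k *\<^sub>v vec_last v (nbus net)"

definition volt_halfspace :: "network \<Rightarrow> nat \<Rightarrow> real vec \<Rightarrow> real vec \<Rightarrow> real vec" where
  "volt_halfspace net k v z = (let n = nk net k in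
     vec n (\<lambda>r. let vl = vmin net k $ r; xc = vcheckRe net k v $ r; yc = vcheckIm net k v $ r in
       hs_c vl xc yc - (hs_a vl xc yc * vRe n z $ r + hs_b vl xc yc * vIm n z $ r)))"

(* The problem obtained by linearizing lambda and mu at zh.  The constraints are in the same order
   as in subproblem, so a multiplier of one problem is a multiplier of the other: the halfspace
   constraints take the place of the lower voltage bounds. *)
definition convex_subproblem ::
    "network \<Rightarrow> real \<Rightarrow> nat \<Rightarrow> real vec \<Rightarrow> real vec \<Rightarrow> real vec \<Rightarrow> nlp" where
  "convex_subproblem net \<rho> k v y zh = (let d = zdim (nk net k) in
     \<lparr> n_var = d, n_eq = n_eq_con (nk net k), n_ineq = n_ineq_con (nk net k),
       objective = local_cost net \<rho> k v y,
       eq_con = (\<lambda>z. alpha_con net k z @\<^sub>v taylor1 d (lambda_con net k) zh z @\<^sub>v taylor1 d (mu_con net k) zh z),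
       ineq_con = (\<lambda>z. beta_con net k z @\<^sub>v gamma_con net k z @\<^sub>v volt_halfspace net k v z @\<^sub>v volt_upper net k z) \<rparr>)"

definition initial_point :: "network \<Rightarrow> nat \<Rightarrow> real vec \<Rightarrow> real vec \<Rightarrow> bool" where
  "initial_point net k v zh \<longleftrightarrow> (let n = nk net k in
     zh \<in> carrier_vec (zdim n) \<and>
     vRe n zh = vcheckRe net k v \<and> vIm n zh = vcheckIm net k v \<and>
     alpha_con net k zh = 0\<^sub>v (4 + 2 * (n - 1)) \<and> lambda_con net k zh = 0\<^sub>v 2 \<and>
     mu_con net k zh = 0\<^sub>v (2 * (n - 1)))"

(* zs m and us m (m \<ge> 1) are the iterates; zh m is the linearization point of iteration m. *)
definition algorithm2 ::
    "network \<Rightarrow> real \<Rightarrow> nat \<Rightarrow> real vec \<Rightarrow> real vec \<Rightarrow> (nat \<Rightarrow> real vec) \<Rightarrow> (nat \<Rightarrow> multipliers) \<Rightarrow> bool" where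
  "algorithm2 net \<rho> k v y zs us \<longleftrightarrow> (\<exists>zh.
     initial_point net k v (zh 1) \<and>
     (\<forall>m\<ge>1. optimal_solution (convex_subproblem net \<rho> k v y (zh m)) (zs m) \<and>
             dual_optimal (convex_subproblem net \<rho> k v y (zh m)) (us m) \<and>
             zh (Suc m) = zs m))"

definition strictly_in_Xcheck :: "network \<Rightarrow> nat \<Rightarrow> real vec \<Rightarrow> real vec \<Rightarrow> bool" where
  "strictly_in_Xcheck net k v z \<longleftrightarrow>
     (\<forall>r<nk net k. volt_halfspace net k v z $ r < 0 \<and> volt_upper net k z $ r < 0)"

section \<open>Dimensions\<close>

lemma dim_eq_con:
  "dim_vec (alpha_con net k z) = 4 + 2 * (nk net k - 1)"
  "dim_vec (lambda_con net k z) = 2"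
  "dim_vec (mu_con net k z) = 2 * (nk net k - 1)"
  unfolding alpha_con_def lambda_con_def mu_con_def Let_def C_mat_def D_mat_def diff_mat_def
    g_vec_def b_vec_def ibRe_def ibIm_def pb_def qb_def block_def
  by (simp_all only: index_append_vec dim_vec_of_list list.size index_minus_vec index_add_vec
      index_smult_vec dim_mult_mat_vec dim_row_mat dim_vec)

lemma dim_ineq_con:
  assumes "valid_network net" "k < nbus net"
  shows "dim_vec (beta_con net k z) = 4 + 2 * (nk net k - 1)"
    and "dim_vec (gamma_con net k z) = 2 * (nk net k - 1)"
    and "dim_vec (volt_lower net k z) = nk net k"
    and "dim_vec (volt_upper net k z) = nk net k"
    and "dim_vec (volt_halfspace net k v z) = nk net k"
proof -
  have pm: "dim_vec (pbar_max net k) = nk net k - 1"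
    using assms unfolding valid_network_def by (blast dest: carrier_vecD)
  show "dim_vec (beta_con net k z) = 4 + 2 * (nk net k - 1)"
    unfolding beta_con_def Let_def pb_def block_def
    by (simp only: index_append_vec dim_vec_of_list list.size index_minus_vec dim_vec pm)
  show "dim_vec (gamma_con net k z) = 2 * (nk net k - 1)"
    unfolding gamma_con_def Let_def by (simp only: index_append_vec dim_vec)
qed (simp_all only: volt_lower_def volt_upper_def volt_halfspace_def Let_def dim_vec)

lemma dim_nlp_con:
  assumes "valid_network net" "k < nbus net"
  shows "dim_vec (eq_con (subproblem net \<rho> k v y) z) = n_eq_con (nk net k)"
    and "dim_vec (ineq_con (subproblem net \<rho> k v y) z) = n_ineq_con (nk net k)"
    and "dim_vec (eq_con (convex_subproblem net \<rho> k v y zh) z) = n_eq_con (nk net k)"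
    and "dim_vec (ineq_con (convex_subproblem net \<rho> k v y zh) z) = n_ineq_con (nk net k)"
  unfolding subproblem_def convex_subproblem_def Let_def nlp.simps n_eq_con_def n_ineq_con_def
  by (simp_all only: index_append_vec taylor1_def dim_vec dim_eq_con dim_ineq_con[OF assms] add.assoc)

end

theory Submission
  imports Defs
begin

text \<open>
The proof rests on two facts. The first is that every convex problem solved by the algorithm has
zero duality gap, so that a dual optimal \<open>u\<close> together with an optimal \<open>z\<close> satisfies
\<open>objective z \<le> lagrangian u w\<close> for all \<open>w\<close>, as well as complementary slackness. No constraint
qualification holds in general (generation bounds may coincide, flow limits may vanish). What
replaces it is boundedness: if the constraints are violated by at most \<open>M\<close>, then every
local variable is bounded in terms of \<open>M\<close>. The generation bounds, the flow bounds and the upper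
voltage bounds control generation, flows and voltages, and the affine equations propagate this to
all other variables. Therefore the quadratic penalty
\<open>(max 0 (objective - c))\<^sup>2 + |eq_con|\<^sup>2 + |max 0 ineq_con|\<^sup>2\<close> attains its minimum. If \<open>c\<close> is below
the optimal value, then the minimum is positive and its first-order condition, divided by the
residual of the objective, provides multipliers whose dual value is at least \<open>c\<close>
(\<open>ex_dual_feasible_near_optimal\<close>, \<open>dual_optimal_saddle_point\<close>).

The second fact is that \<open>lambda_con\<close> and \<open>mu_con\<close> are multiaffine: their quadratic terms are products
of two different coordinates. Hence partial derivatives are differences of values, Taylor
approximations converge when base point and argument converge, and along each coordinate line
through its base point a Taylor approximation agrees with the function itself
(\<open>taylor1_multiaffine_update\<close>).

The saddle point inequality contains no derivatives of the cost, so it passes to the limit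
pointwise: the limit point minimizes the Lagrangian of the convex problem linearized at that same
point. Strict feasibility forces the limit multipliers of the halfspaces to be zero, and since these
are the only inequalities in which the two problems differ, the Lagrangian of the nonconvex problem
coincides with the minimized one on all coordinate lines through the limit point. So its
gradient vanishes there. The lower voltage bounds follow from the halfspaces.
\<close>

section \<open>Affine and continuous functions of the coordinates\<close>

text \<open>
Only values on \<open>carrier_vec d\<close> are constrained, because a vector of another dimension has unspecified
entries. The same convention holds for the other classes of functions below.
\<close>
definition affine_fun :: "nat \<Rightarrow> (real vec \<Rightarrow> real) \<Rightarrow> bool" where
  "affine_fun d F \<longleftrightarrow> (\<exists>c w. \<forall>z\<in>carrier_vec d. F z = c + (\<Sum>i<d. w i * z $ i))"

text \<open>
The type \<open>real vec\<close> carries no topology. Continuity is expressed in the product topology of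
\<open>nat \<Rightarrow> real\<close>, where boxes are compact by Tychonoff's theorem and convergence is coordinatewise.
\<close>
definition coord_continuous :: "nat \<Rightarrow> (real vec \<Rightarrow> real) \<Rightarrow> bool" where
  "coord_continuous d F \<longleftrightarrow> continuous_on UNIV (\<lambda>x :: nat \<Rightarrow> real. F (vec d x))"

text \<open>
A single class holding all that is needed of the objective and of the inequality constraints:
continuity for the existence of minimizers and for limits, partial derivatives for the gradient of the
Lagrangian, and convexity for duality.
\<close>
definition smooth_convex :: "nat \<Rightarrow> (real vec \<Rightarrow> real) \<Rightarrow> bool" where
  "smooth_convex d F \<longleftrightarrow> coord_continuous d F \<and>
     (\<forall>z\<in>carrier_vec d. \<forall>i<d. (\<lambda>t. F (update_vec z i t)) differentiable (at (z $ i))) \<and>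
     (\<forall>x\<in>carrier_vec d. \<forall>y\<in>carrier_vec d. \<forall>t\<in>{0..1}.
        F ((1 - t) \<cdot>\<^sub>v x + t \<cdot>\<^sub>v y) \<le> (1 - t) * F x + t * F y)"

definition multiaffine :: "nat \<Rightarrow> (real vec \<Rightarrow> real) \<Rightarrow> bool" where
  "multiaffine d F \<longleftrightarrow> coord_continuous d F \<and>
     (\<forall>z\<in>carrier_vec d. \<forall>i<d. \<exists>a b. \<forall>t. F (update_vec z i t) = a + b * t)"

lemma update_vec_carrier: "z \<in> carrier_vec d \<Longrightarrow> update_vec z i t \<in> carrier_vec d"
  by (intro carrier_vecI) (simp add: carrier_vecD)

lemma affine_fun_const: "affine_fun d (\<lambda>z. c)"
  unfolding affine_fun_def by (intro exI[of _ c] exI[of _ "\<lambda>_. 0"]) simp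

lemma affine_fun_coord:
  assumes "i < d" shows "affine_fun d (\<lambda>z. z $ i)"
  unfolding affine_fun_def
proof (intro exI[of _ 0] exI[of _ "\<lambda>j. if j = i then 1 else 0"] ballI)
  fix z :: "real vec"
  have "(\<Sum>j<d. (if j = i then 1 else 0) * z $ j) = (\<Sum>j<d. if j = i then z $ j else 0)"
    by (rule sum.cong) auto
  then show "z $ i = 0 + (\<Sum>j<d. (if j = i then 1 else 0) * z $ j)" using assms by simp
qed

lemma affine_fun_add:
  assumes "affine_fun d F" "affine_fun d G" shows "affine_fun d (\<lambda>z. F z + G z)"
proof -
  obtain c w where F: "\<And>z. z \<in> carrier_vec d \<Longrightarrow> F z = c + (\<Sum>i<d. w i * z $ i)"
    using assms(1) unfolding affine_fun_def by blast
  obtain c' w' where G: "\<And>z. z \<in> carrier_vec d \<Longrightarrow> G z = c' + (\<Sum>i<d. w' i * z $ i)"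
    using assms(2) unfolding affine_fun_def by blast
  show ?thesis
    unfolding affine_fun_def
    by (intro exI[of _ "c + c'"] exI[of _ "\<lambda>i. w i + w' i"])
      (simp add: F G algebra_simps sum.distrib)
qed

lemma affine_fun_cmult:
  assumes "affine_fun d F" shows "affine_fun d (\<lambda>z. c * F z)"
proof -
  obtain a w where F: "\<And>z. z \<in> carrier_vec d \<Longrightarrow> F z = a + (\<Sum>i<d. w i * z $ i)"
    using assms unfolding affine_fun_def by blast
  show ?thesis
    unfolding affine_fun_def
    by (intro exI[of _ "c * a"] exI[of _ "\<lambda>i. c * w i"])
      (simp add: F algebra_simps sum_distrib_left)
qed

lemma affine_fun_diff:
  assumes "affine_fun d F" "affine_fun d G" shows "affine_fun d (\<lambda>z. F z - G z)"
  using affine_fun_add[OF assms(1) affine_fun_cmult[OF assms(2), of "- 1"]] by simp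

lemma affine_fun_sum:
  assumes "\<And>j. j \<in> A \<Longrightarrow> affine_fun d (F j)" shows "affine_fun d (\<lambda>z. \<Sum>j\<in>A. F j z)"
  using assms
  by (induction A rule: infinite_finite_induct) (simp_all add: affine_fun_const affine_fun_add)

lemma affine_fun_segment:
  assumes "affine_fun d F" "x \<in> carrier_vec d" "y \<in> carrier_vec d"
  shows "F ((1 - t) \<cdot>\<^sub>v x + t \<cdot>\<^sub>v y) = (1 - t) * F x + t * F y"
proof -
  obtain c w where F: "\<And>z. z \<in> carrier_vec d \<Longrightarrow> F z = c + (\<Sum>i<d. w i * z $ i)"
    using assms(1) unfolding affine_fun_def by blast
  have "(\<Sum>i<d. w i * ((1 - t) \<cdot>\<^sub>v x + t \<cdot>\<^sub>v y) $ i)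
      = (\<Sum>i<d. (1 - t) * (w i * x $ i) + t * (w i * y $ i))"
    using assms by (intro sum.cong) (auto simp: algebra_simps)
  also have "\<dots> = (1 - t) * (\<Sum>i<d. w i * x $ i) + t * (\<Sum>i<d. w i * y $ i)"
    by (simp add: sum.distrib sum_distrib_left)
  finally show ?thesis
    using assms(2,3) F[of "(1 - t) \<cdot>\<^sub>v x + t \<cdot>\<^sub>v y"] by (simp add: F algebra_simps)
qed

lemma affine_fun_update:
  assumes "affine_fun d F" "z \<in> carrier_vec d" "i < d"
  shows "\<exists>a b. \<forall>t. F (update_vec z i t) = a + b * t"
proof -
  obtain c w where F: "\<And>z. z \<in> carrier_vec d \<Longrightarrow> F z = c + (\<Sum>i<d. w i * z $ i)"
    using assms(1) unfolding affine_fun_def by blast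
  have "F (update_vec z i t) = (c + (\<Sum>j\<in>{..<d} - {i}. w j * z $ j)) + w i * t" for t
  proof -
    have "F (update_vec z i t) = c + (\<Sum>j<d. w j * update_vec z i t $ j)"
      using assms by (intro F carrier_vecI) simp
    also have "(\<Sum>j<d. w j * update_vec z i t $ j)
        = w i * t + (\<Sum>j\<in>{..<d} - {i}. w j * z $ j)"
      using assms by (simp add: sum.remove[of _ i])
    finally show ?thesis by simp
  qed
  then show ?thesis by blast
qed

lemma coord_continuous_affine:
  assumes "affine_fun d F" shows "coord_continuous d F"
proof -
  obtain c w where F: "\<And>z. z \<in> carrier_vec d \<Longrightarrow> F z = c + (\<Sum>i<d. w i * z $ i)"
    using assms unfolding affine_fun_def by blast
  have "(\<lambda>x :: nat \<Rightarrow> real. F (vec d x)) = (\<lambda>x. c + (\<Sum>i<d. w i * x i))"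
    by (auto simp: F intro!: ext)
  then show ?thesis unfolding coord_continuous_def
    by (simp only:) (intro continuous_intros continuous_on_product_coordinates)
qed

lemma coord_continuous_compose:
  assumes "coord_continuous d F" "continuous_on UNIV g"
  shows "coord_continuous d (\<lambda>z. g (F z))"
  using assms continuous_on_compose2[of UNIV g UNIV "\<lambda>x. F (vec d x)"]
  unfolding coord_continuous_def by auto

lemma coord_continuous_arith:
  assumes "coord_continuous d F" "coord_continuous d G"
  shows "coord_continuous d (\<lambda>z. F z + G z)" "coord_continuous d (\<lambda>z. F z - G z)"
    "coord_continuous d (\<lambda>z. F z * G z)"
  using assms unfolding coord_continuous_def by (auto intro!: continuous_intros)

lemma coord_continuous_sum:
  assumes "\<And>j. j \<in> A \<Longrightarrow> coord_continuous d (F j)"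
  shows "coord_continuous d (\<lambda>z. \<Sum>j\<in>A. F j z)"
  using assms unfolding coord_continuous_def by (auto intro!: continuous_intros)

lemma vec_tendstoD:
  assumes "vec_tendsto X x" "x \<in> carrier_vec d"
  shows "\<forall>\<^sub>F m in sequentially. X m \<in> carrier_vec d"
    and "\<And>i. i < d \<Longrightarrow> (\<lambda>m. X m $ i) \<longlonglongrightarrow> x $ i"
  using assms unfolding vec_tendsto_def carrier_vec_def by simp_all

lemma vec_tendstoI:
  assumes "x \<in> carrier_vec d" "\<forall>\<^sub>F m in sequentially. X m \<in> carrier_vec d"
    and "\<And>i. i < d \<Longrightarrow> (\<lambda>m. X m $ i) \<longlonglongrightarrow> x $ i"
  shows "vec_tendsto X x"
  using assms unfolding vec_tendsto_def carrier_vec_def by simp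

lemma vec_tendsto_carrier:
  assumes "vec_tendsto X x" "\<And>m. 1 \<le> m \<Longrightarrow> X m \<in> carrier_vec d"
  shows "x \<in> carrier_vec d"
proof -
  have "\<forall>\<^sub>F m in sequentially. dim_vec (X m) = dim_vec x \<and> 1 \<le> m"
    using assms(1) eventually_ge_at_top[of "1 :: nat"] unfolding vec_tendsto_def
    by (auto intro: eventually_conj)
  from eventually_happens'[OF sequentially_bot this]
  obtain m where "dim_vec (X m) = dim_vec x" "1 \<le> m" by blast
  then show ?thesis using assms(2)[of m] by (metis carrier_vecD carrier_vecI)
qed

lemma vec_tendsto_const: "vec_tendsto (\<lambda>m. x) x"
  by (simp add: vec_tendsto_def)

lemma vec_tendsto_Suc_iff: "vec_tendsto (\<lambda>m. X (Suc m)) x \<longleftrightarrow> vec_tendsto X x"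
  by (simp add: vec_tendsto_def filterlim_sequentially_Suc[of "\<lambda>m. X m $ i" for i]
      eventually_sequentially_Suc[of "\<lambda>m. dim_vec (X m) = dim_vec x"])

lemma coord_continuous_tendsto:
  assumes F: "coord_continuous d F"
    and conv: "vec_tendsto X x" and x: "x \<in> carrier_vec d"
  shows "(\<lambda>m. F (X m)) \<longlonglongrightarrow> F x"
proof -
  note X = vec_tendstoD(1)[OF conv x] and lim = vec_tendstoD(2)[OF conv x]
  define pad :: "real vec \<Rightarrow> nat \<Rightarrow> real" where "pad z = (\<lambda>i. if i < d then z $ i else 0)" for z
  have pad: "vec d (pad z) = z" if "z \<in> carrier_vec d" for z
    using that by (intro eq_vecI) (auto simp: pad_def)
  have "limitin (product_topology (\<lambda>_. euclidean) UNIV) (\<lambda>m. pad (X m)) (pad x) sequentially"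
    unfolding limitin_componentwise using lim by (auto simp: pad_def)
  then have "(\<lambda>m. pad (X m)) \<longlonglongrightarrow> pad x"
    by (simp add: euclidean_product_topology)
  then have "(\<lambda>m. F (vec d (pad (X m)))) \<longlonglongrightarrow> F (vec d (pad x))"
    using F continuous_on_tendsto_compose[of UNIV "\<lambda>x. F (vec d x)"]
    unfolding coord_continuous_def by simp
  moreover have "\<forall>\<^sub>F m in sequentially. F (vec d (pad (X m))) = F (X m)"
    using X by eventually_elim (simp add: pad)
  ultimately show ?thesis using x pad Lim_transform_eventually by metis
qed

text \<open>
The weak form of attainment, with a minimizer that may lie anywhere in the carrier, suffices for
functions whose sublevel sets are bounded.
\<close>
lemma coord_continuous_attains_inf_box:
  assumes F: "coord_continuous d F" and "0 \<le> R"
  obtains z0 where "z0 \<in> carrier_vec d"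
    "\<And>z. z \<in> carrier_vec d \<Longrightarrow> (\<And>i. i < d \<Longrightarrow> \<bar>z $ i\<bar> \<le> R) \<Longrightarrow> F z0 \<le> F z"
proof -
  define B :: "(nat \<Rightarrow> real) set" where "B = PiE UNIV (\<lambda>_. {- R..R})"
  have "compactin (product_topology (\<lambda>_. euclidean) UNIV) B"
    unfolding B_def compactin_PiE by simp
  then have "compact B" by (simp add: euclidean_product_topology)
  moreover have "B \<noteq> {}" using \<open>0 \<le> R\<close> by (auto simp: B_def PiE_eq_empty_iff)
  moreover have "continuous_on B (\<lambda>x. F (vec d x))"
    using F continuous_on_subset unfolding coord_continuous_def by blast
  ultimately obtain x0 where x0: "\<And>x. x \<in> B \<Longrightarrow> F (vec d x0) \<le> F (vec d x)"
    using continuous_attains_inf[of B "\<lambda>x. F (vec d x)"] by blast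
  show ?thesis
  proof (rule that[of "vec d x0"])
    fix z :: "real vec" assume z: "z \<in> carrier_vec d" "\<And>i. i < d \<Longrightarrow> \<bar>z $ i\<bar> \<le> R"
    define x where "x = (\<lambda>i. if i < d then z $ i else 0)"
    have "x i \<in> {- R..R}" for i using z(2)[of i] \<open>0 \<le> R\<close> by (auto simp: x_def abs_le_iff)
    then have "x \<in> B" by (simp add: B_def PiE_UNIV_domain)
    moreover have "vec d x = z" using z(1) by (intro eq_vecI) (auto simp: x_def)
    ultimately show "F (vec d x0) \<le> F z" using x0 by metis
  qed simp
qed


section \<open>Convex functions with partial derivatives\<close>

lemma smooth_convexD:
  assumes "smooth_convex d F"
  shows "coord_continuous d F"
    and "\<And>z i. z \<in> carrier_vec d \<Longrightarrow> i < d \<Longrightarrow>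
      (\<lambda>t. F (update_vec z i t)) differentiable (at (z $ i))"
    and "\<And>x y t. x \<in> carrier_vec d \<Longrightarrow> y \<in> carrier_vec d \<Longrightarrow> 0 \<le> t \<Longrightarrow> t \<le> 1 \<Longrightarrow>
      F ((1 - t) \<cdot>\<^sub>v x + t \<cdot>\<^sub>v y) \<le> (1 - t) * F x + t * F y"
  using assms unfolding smooth_convex_def by auto

lemma smooth_convex_compose:
  assumes F: "affine_fun d F" and cvx: "convex_on UNIV g" and diff: "\<And>x. g differentiable (at x)"
  shows "smooth_convex d (\<lambda>z. g (F z))"
  unfolding smooth_convex_def
proof (intro conjI ballI allI impI)
  have "continuous_on UNIV g"
    using diff by (intro differentiable_imp_continuous_on)
      (simp add: differentiable_on_def)
  then show "coord_continuous d (\<lambda>z. g (F z))"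
    by (rule coord_continuous_compose[OF coord_continuous_affine[OF F]])
next
  fix z :: "real vec" and i assume z: "z \<in> carrier_vec d" "i < d"
  obtain a b where ab: "\<And>t. F (update_vec z i t) = a + b * t"
    using affine_fun_update[OF F z] by blast
  have "(g \<circ> (\<lambda>t. a + b * t)) differentiable (at (z $ i))"
    by (intro differentiable_chain_at derivative_intros diff)
  then show "(\<lambda>t. g (F (update_vec z i t))) differentiable (at (z $ i))"
    by (simp add: ab o_def)
next
  fix x y :: "real vec" and t :: real
  assume "x \<in> carrier_vec d" "y \<in> carrier_vec d" "t \<in> {0..1}"
  then show "g (F ((1 - t) \<cdot>\<^sub>v x + t \<cdot>\<^sub>v y)) \<le> (1 - t) * g (F x) + t * g (F y)"
    using convex_onD[OF cvx, of t "F x" "F y"] by (simp add: affine_fun_segment[OF F])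
qed

lemma smooth_convex_affine:
  assumes "affine_fun d F" shows "smooth_convex d F"
  using smooth_convex_compose[OF assms, of "\<lambda>x. x"] by (simp add: convex_on_def)

lemma smooth_convex_square:
  assumes "affine_fun d F" shows "smooth_convex d (\<lambda>z. (F z)\<^sup>2)"
  using smooth_convex_compose[OF assms, of "\<lambda>x. x\<^sup>2"] convex_power2 by simp

lemma smooth_convex_add:
  assumes F: "smooth_convex d F" and G: "smooth_convex d G"
  shows "smooth_convex d (\<lambda>z. F z + G z)"
  unfolding smooth_convex_def
proof (intro conjI ballI allI impI)
  show "coord_continuous d (\<lambda>z. F z + G z)" using smooth_convexD(1)[OF F] smooth_convexD(1)[OF G] by (rule coord_continuous_arith)
next
  fix z :: "real vec" and i assume z: "z \<in> carrier_vec d" "i < d"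
  then show "(\<lambda>t. F (update_vec z i t) + G (update_vec z i t)) differentiable (at (z $ i))"
    by (intro derivative_intros smooth_convexD(2)[OF F] smooth_convexD(2)[OF G])
next
  fix x y :: "real vec" and t :: real
  assume "x \<in> carrier_vec d" "y \<in> carrier_vec d" "t \<in> {0..1}"
  then show "F ((1 - t) \<cdot>\<^sub>v x + t \<cdot>\<^sub>v y) + G ((1 - t) \<cdot>\<^sub>v x + t \<cdot>\<^sub>v y)
      \<le> (1 - t) * (F x + G x) + t * (F y + G y)"
    using smooth_convexD(3)[OF F, of x y t] smooth_convexD(3)[OF G, of x y t]
    by (simp add: algebra_simps)
qed

lemma smooth_convex_diff_const:
  "smooth_convex d F \<Longrightarrow> smooth_convex d (\<lambda>z. F z - c)"
  using smooth_convex_add[OF _ smooth_convex_affine[OF affine_fun_const], of d F "- c"] by simp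

lemma smooth_convex_cmult:
  assumes F: "smooth_convex d F" and "0 \<le> c"
  shows "smooth_convex d (\<lambda>z. c * F z)"
  unfolding smooth_convex_def
proof (intro conjI ballI allI impI)
  show "coord_continuous d (\<lambda>z. c * F z)"
    by (intro coord_continuous_arith coord_continuous_affine affine_fun_const smooth_convexD(1)[OF F])
next
  fix z :: "real vec" and i assume z: "z \<in> carrier_vec d" "i < d"
  then show "(\<lambda>t. c * F (update_vec z i t)) differentiable (at (z $ i))"
    by (intro derivative_intros smooth_convexD(2)[OF F])
next
  fix x y :: "real vec" and t :: real
  assume "x \<in> carrier_vec d" "y \<in> carrier_vec d" "t \<in> {0..1}"
  then have "F ((1 - t) \<cdot>\<^sub>v x + t \<cdot>\<^sub>v y) \<le> (1 - t) * F x + t * F y"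
    using smooth_convexD(3)[OF F] by simp
  then have "c * F ((1 - t) \<cdot>\<^sub>v x + t \<cdot>\<^sub>v y) \<le> c * ((1 - t) * F x + t * F y)"
    using \<open>0 \<le> c\<close> by (rule mult_left_mono)
  then show "c * F ((1 - t) \<cdot>\<^sub>v x + t \<cdot>\<^sub>v y) \<le> (1 - t) * (c * F x) + t * (c * F y)"
    by (simp add: algebra_simps)
qed

lemma smooth_convex_sum:
  assumes "\<And>j. j \<in> A \<Longrightarrow> smooth_convex d (F j)"
  shows "smooth_convex d (\<lambda>z. \<Sum>j\<in>A. F j z)"
  using assms
  by (induction A rule: infinite_finite_induct)
    (simp_all add: smooth_convex_add smooth_convex_affine affine_fun_const)


section \<open>Multiaffine functions and their Taylor approximations\<close>

lemma multiaffine_affine: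
  assumes "affine_fun d F" shows "multiaffine d F"
  unfolding multiaffine_def
proof (intro conjI ballI allI impI)
  show "coord_continuous d F" using assms by (rule coord_continuous_affine)
  fix z :: "real vec" and i assume "z \<in> carrier_vec d" "i < d"
  then show "\<exists>a b. \<forall>t. F (update_vec z i t) = a + b * t"
    by (rule affine_fun_update[OF assms])
qed

lemma multiaffine_diff:
  assumes "multiaffine d F" "multiaffine d G" shows "multiaffine d (\<lambda>z. F z - G z)"
  unfolding multiaffine_def
proof (intro conjI ballI allI impI)
  show "coord_continuous d (\<lambda>z. F z - G z)"
    using assms unfolding multiaffine_def by (intro coord_continuous_arith) simp_all
  fix z :: "real vec" and i assume z: "z \<in> carrier_vec d" "i < d"
  obtain a b a' b' where "\<And>t. F (update_vec z i t) = a + b * t" "\<And>t. G (update_vec z i t) = a' + b' * t"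
    using assms z unfolding multiaffine_def by meson
  then show "\<exists>a b. \<forall>t. F (update_vec z i t) - G (update_vec z i t) = a + b * t"
    by (intro exI[of _ "a - a'"] exI[of _ "b - b'"]) (simp add: algebra_simps)
qed

lemma multiaffine_add:
  assumes "multiaffine d F" "multiaffine d G" shows "multiaffine d (\<lambda>z. F z + G z)"
proof -
  have "multiaffine d (\<lambda>z. F z - (0 - G z))"
    using assms by (intro multiaffine_diff multiaffine_affine[OF affine_fun_const])
  then show ?thesis by simp
qed

lemma multiaffine_coord_mult:
  assumes "i < d" "j < d" "i \<noteq> j" shows "multiaffine d (\<lambda>z. z $ i * z $ j)"
  unfolding multiaffine_def
proof (intro conjI ballI allI impI)
  show "coord_continuous d (\<lambda>z. z $ i * z $ j)"
    using assms by (intro coord_continuous_arith coord_continuous_affine affine_fun_coord)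
  fix z :: "real vec" and l assume z: "z \<in> carrier_vec d" "l < d"
  consider "l = i" | "l = j" | "l \<noteq> i" "l \<noteq> j" by blast
  then show "\<exists>a b. \<forall>t. update_vec z l t $ i * update_vec z l t $ j = a + b * t"
  proof cases
    case 1
    then show ?thesis using assms z by (intro exI[of _ 0] exI[of _ "z $ j"]) simp
  next
    case 2
    then show ?thesis using assms z by (intro exI[of _ 0] exI[of _ "z $ i"]) simp
  next
    case 3
    then show ?thesis by (intro exI[of _ "z $ i * z $ j"] exI[of _ 0]) simp
  qed
qed

text \<open>
The slope of an affine function is its increment over the unit interval. This expresses the gradient
through values of \<open>F\<close>, so continuity of \<open>F\<close> yields continuity of the gradient.
\<close>
lemma gradient_multiaffine:
  assumes "multiaffine d F" "a \<in> carrier_vec d" "i < d"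
  shows "gradient d F a $ i = F (update_vec a i 1) - F (update_vec a i 0)"
proof -
  obtain p q where pq: "\<And>t. F (update_vec a i t) = p + q * t"
    using assms unfolding multiaffine_def by meson
  have "((\<lambda>t. F (update_vec a i t)) has_real_derivative q) (at (a $ i))"
    unfolding pq by (auto intro!: derivative_eq_intros)
  then have "gradient d F a $ i = q"
    using assms(3) by (simp add: gradient_def DERIV_imp_deriv)
  then show ?thesis by (simp add: pq)
qed

lemma scalar_prod_diff_sum:
  assumes "a \<in> carrier_vec d" "z \<in> carrier_vec d"
  shows "w \<bullet> (z - a) = (\<Sum>i<d. w $ i * (z $ i - a $ i))"
  using assms by (auto simp: scalar_prod_def lessThan_atLeast0 intro!: sum.cong)

lemma taylor1_index:
  assumes "i < dim_vec (F a)" "a \<in> carrier_vec d" "z \<in> carrier_vec d"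
  shows "taylor1 d F a z $ i = F a $ i + (\<Sum>j<d. gradient d (\<lambda>w. F w $ i) a $ j * (z $ j - a $ j))"
  using assms by (simp add: taylor1_def scalar_prod_diff_sum)

lemma affine_fun_cong:
  assumes "\<And>z. z \<in> carrier_vec d \<Longrightarrow> F z = G z" "affine_fun d G"
  shows "affine_fun d F"
  using assms unfolding affine_fun_def by simp

lemma affine_fun_taylor1:
  assumes "i < dim_vec (F a)" "a \<in> carrier_vec d"
  shows "affine_fun d (\<lambda>z. taylor1 d F a z $ i)"
  by (rule affine_fun_cong, rule taylor1_index[of i F a d, OF assms])
    (auto intro!: affine_fun_sum affine_fun_cmult affine_fun_add affine_fun_diff
      affine_fun_const affine_fun_coord)

text \<open>
Only the partial derivative in direction \<open>l\<close> contributes on this line, where \<open>F\<close> is affine and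
therefore equal to its linearization.
\<close>
lemma taylor1_multiaffine_update:
  assumes "multiaffine d (\<lambda>w. F w $ i)" "i < dim_vec (F a)" "a \<in> carrier_vec d" "l < d"
  shows "taylor1 d F a (update_vec a l t) $ i = F (update_vec a l t) $ i"
proof -
  let ?f = "\<lambda>w. F w $ i"
  obtain p q where pq: "\<And>t. ?f (update_vec a l t) = p + q * t"
    using assms(1,3,4) unfolding multiaffine_def by meson
  have "update_vec a l (a $ l) = a" by (intro eq_vecI) (auto simp: update_vec_def)
  then have Fa: "F a $ i = p + q * a $ l" using pq[of "a $ l"] by simp
  have "(\<Sum>j<d. gradient d ?f a $ j * (update_vec a l t $ j - a $ j))
      = (\<Sum>j<d. if j = l then gradient d ?f a $ j * (t - a $ l) else 0)"
    using assms(3) by (intro sum.cong) auto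
  also have "\<dots> = q * (t - a $ l)"
    using assms by (simp add: gradient_multiaffine[OF assms(1,3)] pq)
  finally show ?thesis
    using assms pq[of t] Fa taylor1_index[of i F a d "update_vec a l t"] update_vec_carrier[OF assms(3), of l t]
    by (simp add: algebra_simps)
qed

lemma taylor1_multiaffine_tendsto:
  assumes F: "multiaffine d (\<lambda>w. F w $ i)" and dim: "\<And>w. i < dim_vec (F w)"
    and Aa: "vec_tendsto A a" and a: "a \<in> carrier_vec d"
    and Xx: "vec_tendsto X x" and x: "x \<in> carrier_vec d"
  shows "(\<lambda>m. taylor1 d F (A m) (X m) $ i) \<longlonglongrightarrow> taylor1 d F a x $ i"
proof -
  note A = vec_tendstoD(1)[OF Aa a] and Alim = vec_tendstoD(2)[OF Aa a]
  note X = vec_tendstoD(1)[OF Xx x] and Xlim = vec_tendstoD(2)[OF Xx x]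
  let ?f = "\<lambda>w. F w $ i"
  have cont: "coord_continuous d ?f" using F unfolding multiaffine_def by blast
  have upd: "(\<lambda>m. ?f (update_vec (A m) j t)) \<longlonglongrightarrow> ?f (update_vec a j t)" if "j < d" for j t
  proof (rule coord_continuous_tendsto[OF cont vec_tendstoI])
    show "\<forall>\<^sub>F m in sequentially. update_vec (A m) j t \<in> carrier_vec d"
      using A by eventually_elim (rule update_vec_carrier)
    show "update_vec a j t \<in> carrier_vec d" "update_vec a j t \<in> carrier_vec d"
      using a by (simp_all add: update_vec_carrier)
    fix l assume l: "l < d"
    have "\<forall>\<^sub>F m in sequentially. update_vec (A m) j t $ l = (if l = j then t else A m $ l)"
      using A by eventually_elim (use l in auto)
    moreover have "(\<lambda>m. if l = j then t else A m $ l) \<longlonglongrightarrow> update_vec a j t $ l"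
      using Alim[OF l] a l by (cases "l = j") simp_all
    ultimately show "(\<lambda>m. update_vec (A m) j t $ l) \<longlonglongrightarrow> update_vec a j t $ l"
      by (simp add: tendsto_cong)
  qed
  have "(\<lambda>m. ?f (A m) + (\<Sum>j<d. (?f (update_vec (A m) j 1) - ?f (update_vec (A m) j 0)) * (X m $ j - A m $ j)))
     \<longlonglongrightarrow> ?f a + (\<Sum>j<d. (?f (update_vec a j 1) - ?f (update_vec a j 0)) * (x $ j - a $ j))"
    by (intro tendsto_intros upd Alim Xlim coord_continuous_tendsto[OF cont Aa a]) auto
  moreover have eq: "taylor1 d F b w $ i =
      ?f b + (\<Sum>j<d. (?f (update_vec b j 1) - ?f (update_vec b j 0)) * (w $ j - b $ j))"
    if "b \<in> carrier_vec d" "w \<in> carrier_vec d" for b w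
    using that by (simp add: taylor1_index dim gradient_multiaffine[OF F])
  moreover have "\<forall>\<^sub>F m in sequentially. taylor1 d F (A m) (X m) $ i =
      ?f (A m) + (\<Sum>j<d. (?f (update_vec (A m) j 1) - ?f (update_vec (A m) j 0)) * (X m $ j - A m $ j))"
    using A X by eventually_elim (rule eq)
  ultimately show ?thesis using eq[OF a x] by (simp add: tendsto_cong)
qed

section \<open>Strong duality by a quadratic penalty\<close>

text \<open>
Boundedness is required of all perturbed feasible sets, not just of the feasible set: this is
the substitute for a constraint qualification in the absence of interior points.
\<close>
definition bounded_convex_nlp :: "nlp \<Rightarrow> bool" where
  "bounded_convex_nlp P \<longleftrightarrow>
     smooth_convex (n_var P) (objective P) \<and>
     (\<forall>z. dim_vec (eq_con P z) = n_eq P \<and> dim_vec (ineq_con P z) = n_ineq P) \<and>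
     (\<forall>i<n_eq P. affine_fun (n_var P) (\<lambda>z. eq_con P z $ i)) \<and>
     (\<forall>i<n_ineq P. smooth_convex (n_var P) (\<lambda>z. ineq_con P z $ i)) \<and>
     (\<forall>M. \<exists>R. \<forall>z\<in>carrier_vec (n_var P).
        (\<forall>i<n_eq P. \<bar>eq_con P z $ i\<bar> \<le> M) \<longrightarrow> (\<forall>i<n_ineq P. ineq_con P z $ i \<le> M) \<longrightarrow>
        (\<forall>i<n_var P. \<bar>z $ i\<bar> \<le> R))"

lemma nonneg_vecD: "0\<^sub>v n \<le> (v :: real vec) \<Longrightarrow> i < n \<Longrightarrow> 0 \<le> v $ i"
  unfolding less_eq_vec_def by (metis index_zero_vec)

lemma nonpos_vecD: "(v :: real vec) \<le> 0\<^sub>v n \<Longrightarrow> i < n \<Longrightarrow> v $ i \<le> 0"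
  unfolding less_eq_vec_def by (metis index_zero_vec)

text \<open>
The squared positive part is differentiable with derivative \<open>2 * max 0 a\<close>, and its second-order
remainder is at most \<open>s\<^sup>2\<close>. This replaces differentiation in the first-order condition below.
\<close>
lemma pos_part_square_add_le:
  fixes a s :: real
  shows "(max 0 (a + s))\<^sup>2 \<le> (max 0 a)\<^sup>2 + 2 * s * max 0 a + s\<^sup>2"
proof (cases "0 \<le> a")
  case True
  have "(max 0 (a + s))\<^sup>2 \<le> (a + s)\<^sup>2" by (simp add: max_def)
  also have "\<dots> = (max 0 a)\<^sup>2 + 2 * s * max 0 a + s\<^sup>2"
    using True by (simp add: power2_eq_square algebra_simps)
  finally show ?thesis .
next
  case False
  then have "(max 0 (a + s))\<^sup>2 \<le> \<bar>s\<bar>\<^sup>2" by (intro power_mono) auto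
  then show ?thesis using False by simp
qed

lemma nonneg_if_quadratic_nonneg:
  fixes D Q :: real
  assumes "\<And>t. 0 < t \<Longrightarrow> t \<le> 1 \<Longrightarrow> 0 \<le> 2 * t * D + t\<^sup>2 * Q" and "0 \<le> Q"
  shows "0 \<le> D"
proof (rule ccontr)
  assume "\<not> 0 \<le> D"
  then have D: "D < 0" by simp
  define t where "t = min 1 (- D / (Q + 1))"
  have t: "0 < t" "t \<le> 1" using D \<open>0 \<le> Q\<close> by (auto simp: t_def divide_neg_pos)
  have "t * Q \<le> - D / (Q + 1) * Q" using \<open>0 \<le> Q\<close> by (intro mult_right_mono) (auto simp: t_def)
  also have "\<dots> \<le> - D" using D \<open>0 \<le> Q\<close> by (simp add: field_simps)
  finally have "2 * D + t * Q < 0" using D by simp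
  then have "t * (2 * D + t * Q) < 0" using t by (simp add: mult_pos_neg)
  then show False using assms(1)[OF t] by (simp add: power2_eq_square algebra_simps)
qed

lemma lagrangian_sum:
  assumes "dim_vec (eq_con P z) = n_eq P" "dim_vec (ineq_con P z) = n_ineq P"
  shows "lagrangian P u z = objective P z + (\<Sum>i<n_eq P. fst u $ i * eq_con P z $ i)
    + (\<Sum>i<n_ineq P. snd u $ i * ineq_con P z $ i)"
  using assms by (simp add: lagrangian_def scalar_prod_def lessThan_atLeast0)

lemma lagrangian_smooth_convex:
  assumes P: "bounded_convex_nlp P" and u: "dual_feasible P u"
  shows "smooth_convex (n_var P) (lagrangian P u)"
proof -
  have dims: "\<And>z. dim_vec (eq_con P z) = n_eq P" "\<And>z. dim_vec (ineq_con P z) = n_ineq P"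
    and obj: "smooth_convex (n_var P) (objective P)"
    and e: "\<And>i. i < n_eq P \<Longrightarrow> affine_fun (n_var P) (\<lambda>z. eq_con P z $ i)"
    and g: "\<And>i. i < n_ineq P \<Longrightarrow> smooth_convex (n_var P) (\<lambda>z. ineq_con P z $ i)"
    using P unfolding bounded_convex_nlp_def by auto
  have "0\<^sub>v (n_ineq P) \<le> snd u" using u unfolding dual_feasible_def by blast
  then have "smooth_convex (n_var P) (\<lambda>z. objective P z + (\<Sum>i<n_eq P. fst u $ i * eq_con P z $ i)
    + (\<Sum>i<n_ineq P. snd u $ i * ineq_con P z $ i))"
    by (intro smooth_convex_add smooth_convex_sum smooth_convex_cmult obj g
        smooth_convex_affine[OF affine_fun_cmult] e) (auto intro: nonneg_vecD)
  then show ?thesis using lagrangian_sum[OF dims, of u] by presburger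
qed

text \<open>
A minimizer \<open>z0\<close> of the penalty is compared with the points \<open>(1 - t) z0 + t z\<close>. By convexity the
penalty there is at most \<open>\<phi> z0 + 2 t D + t\<^sup>2 Q\<close>, where \<open>D\<close> is linear in the increments of the
functions with the residuals at \<open>z0\<close> as weights. Letting \<open>t\<close> tend to 0 gives \<open>0 \<le> D\<close>. So the
residuals act as multipliers: the Lagrangian formed with them is minimal at \<open>z0\<close>.
\<close>
lemma penalty_first_order:
  fixes f :: "real vec \<Rightarrow> real" and e g :: "nat \<Rightarrow> real vec \<Rightarrow> real" and p q :: nat
  defines "\<phi> \<equiv> \<lambda>z. (max 0 (f z))\<^sup>2 + (\<Sum>i<p. (e i z)\<^sup>2) + (\<Sum>i<q. (max 0 (g i z))\<^sup>2)"
  assumes f: "smooth_convex d f" and e: "\<And>i. i < p \<Longrightarrow> affine_fun d (e i)"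
    and g: "\<And>i. i < q \<Longrightarrow> smooth_convex d (g i)"
    and z0: "z0 \<in> carrier_vec d" and min: "\<And>z. z \<in> carrier_vec d \<Longrightarrow> \<phi> z0 \<le> \<phi> z"
    and z: "z \<in> carrier_vec d"
  shows "\<phi> z0 \<le> max 0 (f z0) * f z + (\<Sum>i<p. e i z0 * e i z) + (\<Sum>i<q. max 0 (g i z0) * g i z)"
proof -
  define D where "D = (f z - f z0) * max 0 (f z0) + (\<Sum>i<p. (e i z - e i z0) * e i z0)
    + (\<Sum>i<q. (g i z - g i z0) * max 0 (g i z0))"
  define Q where "Q = (f z - f z0)\<^sup>2 + (\<Sum>i<p. (e i z - e i z0)\<^sup>2) + (\<Sum>i<q. (g i z - g i z0)\<^sup>2)"
  have "0 \<le> D"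
  proof (rule nonneg_if_quadratic_nonneg)
    show "0 \<le> Q" unfolding Q_def by (intro add_nonneg_nonneg sum_nonneg) auto
    fix t :: real assume t: "0 < t" "t \<le> 1"
    let ?zt = "(1 - t) \<cdot>\<^sub>v z0 + t \<cdot>\<^sub>v z"
    have conv: "(max 0 (F ?zt))\<^sup>2
        \<le> (max 0 (F z0))\<^sup>2 + 2 * (t * (F z - F z0)) * max 0 (F z0) + (t * (F z - F z0))\<^sup>2"
      if F: "smooth_convex d F" for F
    proof -
      have "F ?zt \<le> F z0 + t * (F z - F z0)"
        using smooth_convexD(3)[OF F z0 z, of t] t by (simp add: algebra_simps)
      then have "(max 0 (F ?zt))\<^sup>2 \<le> (max 0 (F z0 + t * (F z - F z0)))\<^sup>2"
        by (intro power_mono) auto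
      also note pos_part_square_add_le
      finally show ?thesis .
    qed
    have aff: "(e i ?zt)\<^sup>2 = (e i z0)\<^sup>2 + 2 * (t * (e i z - e i z0)) * e i z0 + (t * (e i z - e i z0))\<^sup>2"
      if "i < p" for i
      unfolding affine_fun_segment[OF e[OF that] z0 z] by (simp add: power2_eq_square algebra_simps)
    have expand: "(\<Sum>i<n. A i + 2 * (t * B i) * C i + (t * B i)\<^sup>2)
        = (\<Sum>i<n. A i) + 2 * t * (\<Sum>i<n. B i * C i) + t\<^sup>2 * (\<Sum>i<n. (B i)\<^sup>2)"
      for A B C :: "nat \<Rightarrow> real" and n
      by (simp add: sum.distrib sum_distrib_left power_mult_distrib mult_ac)
    have "\<phi> z0 \<le> \<phi> ?zt" using z0 z by (intro min) simp
    also have "\<dots> \<le> ((max 0 (f z0))\<^sup>2 + 2 * (t * (f z - f z0)) * max 0 (f z0) + (t * (f z - f z0))\<^sup>2)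
      + (\<Sum>i<p. (e i z0)\<^sup>2 + 2 * (t * (e i z - e i z0)) * e i z0 + (t * (e i z - e i z0))\<^sup>2)
      + (\<Sum>i<q. (max 0 (g i z0))\<^sup>2 + 2 * (t * (g i z - g i z0)) * max 0 (g i z0) + (t * (g i z - g i z0))\<^sup>2)"
      unfolding \<phi>_def by (intro add_mono sum_mono conv f) (simp_all add: aff conv g)
    also have "\<dots> = \<phi> z0 + (2 * t * D + t\<^sup>2 * Q)"
      unfolding \<phi>_def D_def Q_def expand by (simp add: power_mult_distrib distrib_left)
    finally show "0 \<le> 2 * t * D + t\<^sup>2 * Q" by simp
  qed
  have pos: "(b - a) * max 0 a = max 0 a * b - (max 0 a)\<^sup>2" for a b :: real
    by (simp add: max_def power2_eq_square algebra_simps)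
  have sq: "(b - a) * a = a * b - a\<^sup>2" for a b :: real
    by (simp add: power2_eq_square algebra_simps)
  have "D = (max 0 (f z0) * f z + (\<Sum>i<p. e i z0 * e i z) + (\<Sum>i<q. max 0 (g i z0) * g i z)) - \<phi> z0"
    unfolding D_def \<phi>_def pos sq by (simp add: sum_subtractf)
  then show ?thesis using \<open>0 \<le> D\<close> by simp
qed

text \<open>
A bound on the penalty bounds the violation of every constraint. Hence sublevel sets of the penalty
lie in a box, whatever the objective does.
\<close>
lemma penalty_minimizer:
  fixes f :: "real vec \<Rightarrow> real" and e g :: "nat \<Rightarrow> real vec \<Rightarrow> real" and p q :: nat
  defines "\<phi> \<equiv> \<lambda>z. (max 0 (f z))\<^sup>2 + (\<Sum>i<p. (e i z)\<^sup>2) + (\<Sum>i<q. (max 0 (g i z))\<^sup>2)"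
  assumes f: "smooth_convex d f" and e: "\<And>i. i < p \<Longrightarrow> affine_fun d (e i)"
    and g: "\<And>i. i < q \<Longrightarrow> smooth_convex d (g i)"
    and bdd: "\<And>M. \<exists>R. \<forall>z\<in>carrier_vec d.
        (\<forall>i<p. \<bar>e i z\<bar> \<le> M) \<longrightarrow> (\<forall>i<q. g i z \<le> M) \<longrightarrow> (\<forall>i<d. \<bar>z $ i\<bar> \<le> R)"
  obtains z0 where "z0 \<in> carrier_vec d" "\<And>z. z \<in> carrier_vec d \<Longrightarrow> \<phi> z0 \<le> \<phi> z"
proof -
  define z1 :: "real vec" where "z1 = 0\<^sub>v d"
  have z1: "z1 \<in> carrier_vec d" by (simp add: z1_def)
  define M where "M = sqrt (\<phi> z1)"
  obtain R0 where R0: "\<And>z i. z \<in> carrier_vec d \<Longrightarrow> (\<forall>i<p. \<bar>e i z\<bar> \<le> M) \<Longrightarrow>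
      (\<forall>i<q. g i z \<le> M) \<Longrightarrow> i < d \<Longrightarrow> \<bar>z $ i\<bar> \<le> R0"
    using bdd[of M] by blast
  define R where "R = max 0 R0"
  have sublevel: "\<bar>z $ i\<bar> \<le> R" if z: "z \<in> carrier_vec d" "\<phi> z \<le> \<phi> z1" and i: "i < d" for z i
  proof -
    have "(e j z)\<^sup>2 \<le> \<phi> z" if "j < p" for j
    proof -
      have "(e j z)\<^sup>2 \<le> (\<Sum>i<p. (e i z)\<^sup>2)"
        using that member_le_sum[of j "{..<p}" "\<lambda>i. (e i z)\<^sup>2"] by simp
      moreover have "0 \<le> (\<Sum>i<q. (max 0 (g i z))\<^sup>2)" by (intro sum_nonneg) auto
      ultimately show ?thesis unfolding \<phi>_def by (simp add: add_increasing add_increasing2)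
    qed
    then have "\<forall>j<p. \<bar>e j z\<bar> \<le> M" using z(2) unfolding M_def
      by (metis order_trans real_sqrt_abs real_sqrt_le_mono)
    moreover have "(max 0 (g j z))\<^sup>2 \<le> \<phi> z" if "j < q" for j
    proof -
      have "(max 0 (g j z))\<^sup>2 \<le> (\<Sum>i<q. (max 0 (g i z))\<^sup>2)"
        using that member_le_sum[of j "{..<q}" "\<lambda>i. (max 0 (g i z))\<^sup>2"] by simp
      moreover have "0 \<le> (\<Sum>i<p. (e i z)\<^sup>2)" by (intro sum_nonneg) auto
      ultimately show ?thesis unfolding \<phi>_def by (simp add: add_increasing)
    qed
    then have "\<forall>j<q. \<bar>max 0 (g j z)\<bar> \<le> M" using z(2) unfolding M_def
      by (metis order_trans real_sqrt_abs real_sqrt_le_mono)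
    then have "\<forall>j<q. g j z \<le> M" by (auto simp: abs_le_iff)
    ultimately show ?thesis using R0[OF z(1) _ _ i] by (auto simp: R_def)
  qed
  have "coord_continuous d \<phi>"
    unfolding \<phi>_def
    by (intro coord_continuous_arith(1) coord_continuous_sum
        coord_continuous_compose[of _ _ "\<lambda>x. (max 0 x)\<^sup>2"] coord_continuous_compose[of _ _ "\<lambda>x. x\<^sup>2"]
        smooth_convexD(1)[OF f] smooth_convexD(1)[OF g] coord_continuous_affine e continuous_intros) auto
  then obtain z0 where z0: "z0 \<in> carrier_vec d"
    and box: "\<And>z. z \<in> carrier_vec d \<Longrightarrow> (\<And>i. i < d \<Longrightarrow> \<bar>z $ i\<bar> \<le> R) \<Longrightarrow> \<phi> z0 \<le> \<phi> z"
    using coord_continuous_attains_inf_box[of d \<phi> R] by (auto simp: R_def)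
  show ?thesis
  proof (rule that[OF z0])
    fix z :: "real vec" assume z: "z \<in> carrier_vec d"
    show "\<phi> z0 \<le> \<phi> z"
    proof (cases "\<phi> z \<le> \<phi> z1")
      case True
      then show ?thesis using box sublevel z by blast
    next
      case False
      then show ?thesis using box[OF z1] sublevel[OF z1] by fastforce
    qed
  qed
qed

text \<open>
The penalty is formed with the residual \<open>objective - c\<close>. Its minimum is positive because no feasible
point attains a value \<open>\<le> c\<close>. Evaluating the first-order condition at the optimal point shows that the
residual \<open>\<tau>\<close> of the objective is positive, and division by \<open>\<tau>\<close> normalizes the residuals of the
constraints to multipliers with dual value at least \<open>c\<close>.
\<close>
lemma ex_dual_feasible_near_optimal:
  assumes P: "bounded_convex_nlp P" and opt: "optimal_solution P z" and c: "c < objective P z"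
  obtains u where "dual_feasible P u" "\<And>w. w \<in> carrier_vec (n_var P) \<Longrightarrow> c \<le> lagrangian P u w"
proof -
  define d p q where "d = n_var P" and "p = n_eq P" and "q = n_ineq P"
  define f where "f = (\<lambda>w. objective P w + (- c))"
  define e where "e = (\<lambda>i w. eq_con P w $ i)"
  define g where "g = (\<lambda>i w. ineq_con P w $ i)"
  define \<phi> where "\<phi> = (\<lambda>w. (max 0 (f w))\<^sup>2 + (\<Sum>i<p. (e i w)\<^sup>2) + (\<Sum>i<q. (max 0 (g i w))\<^sup>2))"
  have dims: "\<And>w. dim_vec (eq_con P w) = p" "\<And>w. dim_vec (ineq_con P w) = q"
    using P unfolding bounded_convex_nlp_def p_def q_def by auto
  have f: "smooth_convex d f"
    unfolding f_def using P unfolding bounded_convex_nlp_def d_def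
    by (intro smooth_convex_add[OF _ smooth_convex_affine[OF affine_fun_const]]) simp
  have e: "\<And>i. i < p \<Longrightarrow> affine_fun d (e i)" and g: "\<And>i. i < q \<Longrightarrow> smooth_convex d (g i)"
    and bdd: "\<And>M. \<exists>R. \<forall>z\<in>carrier_vec d.
        (\<forall>i<p. \<bar>e i z\<bar> \<le> M) \<longrightarrow> (\<forall>i<q. g i z \<le> M) \<longrightarrow> (\<forall>i<d. \<bar>z $ i\<bar> \<le> R)"
    using P unfolding bounded_convex_nlp_def d_def p_def q_def e_def g_def by auto
  obtain z0 where z0: "z0 \<in> carrier_vec d" and min: "\<And>w. w \<in> carrier_vec d \<Longrightarrow> \<phi> z0 \<le> \<phi> w"
    using penalty_minimizer[OF f e g bdd] unfolding \<phi>_def by blast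
  define \<tau> where "\<tau> = max 0 (f z0)"
  have first: "\<phi> z0 \<le> \<tau> * f w + (\<Sum>i<p. e i z0 * e i w) + (\<Sum>i<q. max 0 (g i z0) * g i w)"
    if "w \<in> carrier_vec d" for w
    using penalty_first_order[OF f e g z0 min[unfolded \<phi>_def] that] unfolding \<phi>_def \<tau>_def by blast
  have z: "z \<in> carrier_vec d" and ez: "\<And>i. i < p \<Longrightarrow> e i z = 0" and gz: "\<And>i. i < q \<Longrightarrow> g i z \<le> 0"
    using opt nonpos_vecD[of "ineq_con P z" q]
    unfolding optimal_solution_def feasible_def d_def p_def q_def e_def g_def by auto
  have "\<phi> z0 > 0"
  proof (rule ccontr)
    assume "\<not> \<phi> z0 > 0"
    moreover have "0 \<le> (\<Sum>i<p. (e i z0)\<^sup>2)" "0 \<le> (\<Sum>i<q. (max 0 (g i z0))\<^sup>2)"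
      by (auto intro: sum_nonneg)
    moreover have "0 \<le> (max 0 (f z0))\<^sup>2" by simp
    ultimately have zero: "(max 0 (f z0))\<^sup>2 = 0" "(\<Sum>i<p. (e i z0)\<^sup>2) = 0"
      "(\<Sum>i<q. (max 0 (g i z0))\<^sup>2) = 0" unfolding \<phi>_def by linarith+
    have "\<forall>i<p. e i z0 = 0" using zero(2) by (subst (asm) sum_nonneg_eq_0_iff) auto
    moreover have "\<forall>i<q. max 0 (g i z0) = 0" using zero(3) by (subst (asm) sum_nonneg_eq_0_iff) auto
    ultimately have "feasible P z0"
      using z0 dims unfolding feasible_def e_def g_def d_def p_def q_def less_eq_vec_def
      by (auto intro!: eq_vecI simp: max_def split: if_splits)
    then have "objective P z \<le> objective P z0" using opt unfolding optimal_solution_def by blast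
    moreover have "f z0 \<le> 0" using zero(1) by (simp add: max_def split: if_splits)
    ultimately show False using c by (simp add: f_def)
  qed
  moreover have "(\<Sum>i<q. max 0 (g i z0) * g i z) \<le> 0"
    using gz by (intro sum_nonpos) (auto intro: mult_nonneg_nonpos)
  ultimately have "\<tau> * f z > 0" using first[OF z] ez by simp
  moreover have "0 \<le> \<tau>" by (simp add: \<tau>_def)
  ultimately have \<tau>: "\<tau> > 0" by (cases "\<tau> = 0") auto
  define u where "u = (vec p (\<lambda>i. e i z0 / \<tau>), vec q (\<lambda>i. max 0 (g i z0) / \<tau>))"
  show ?thesis
  proof (rule that[of u])
    show "dual_feasible P u"
      using \<tau> unfolding dual_feasible_def u_def p_def[symmetric] q_def[symmetric]
      by (auto simp: less_eq_vec_def)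
    fix w :: "real vec" assume "w \<in> carrier_vec (n_var P)"
    then have "0 < \<tau> * f w + (\<Sum>i<p. e i z0 * e i w) + (\<Sum>i<q. max 0 (g i z0) * g i w)"
      using first[of w] \<open>\<phi> z0 > 0\<close> by (simp add: d_def)
    also have "\<dots> = \<tau> * (f w + (\<Sum>i<p. e i z0 / \<tau> * e i w) + (\<Sum>i<q. max 0 (g i z0) / \<tau> * g i w))"
      using \<tau> by (simp add: distrib_left sum_distrib_left)
    also have "\<dots> = \<tau> * (lagrangian P u w - c)"
      using dims unfolding u_def f_def
      by (simp add: lagrangian_sum p_def q_def e_def g_def)
    finally show "c \<le> lagrangian P u w" using \<tau> by (simp add: zero_less_mult_iff)
  qed
qed

text \<open>
The preceding lemma bounds the dual optimal value below by each \<open>c\<close> less than the optimal value, so there is no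
duality gap. Evaluating the resulting inequality at \<open>z\<close> itself leaves a sum of nonpositive terms
that is nonnegative, which gives complementary slackness.
\<close>
theorem dual_optimal_saddle_point:
  assumes P: "bounded_convex_nlp P" and opt: "optimal_solution P z" and dual: "dual_optimal P u"
  shows "\<And>w. w \<in> carrier_vec (n_var P) \<Longrightarrow> objective P z \<le> lagrangian P u w"
    and "\<And>i. i < n_ineq P \<Longrightarrow> snd u $ i * ineq_con P z $ i = 0"
proof -
  show bound: "objective P z \<le> lagrangian P u w" if w: "w \<in> carrier_vec (n_var P)" for w
  proof (rule dense_le)
    fix c assume c: "c < objective P z"
    obtain u' where u': "dual_feasible P u'"
      "\<And>w. w \<in> carrier_vec (n_var P) \<Longrightarrow> c \<le> lagrangian P u' w"
      using ex_dual_feasible_near_optimal[OF P opt c] by blast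
    have "ereal c \<le> dual_function P u'"
      unfolding dual_function_def using u'(2) by (intro INF_greatest) simp
    also have "\<dots> \<le> dual_function P u" using dual u'(1) unfolding dual_optimal_def by blast
    also have "\<dots> \<le> ereal (lagrangian P u w)"
      unfolding dual_function_def using w by (rule INF_lower)
    finally show "c \<le> lagrangian P u w" by simp
  qed
  have dims: "dim_vec (eq_con P z) = n_eq P" "dim_vec (ineq_con P z) = n_ineq P"
    using P unfolding bounded_convex_nlp_def by auto
  have feas: "z \<in> carrier_vec (n_var P)" "eq_con P z = 0\<^sub>v (n_eq P)"
    "\<And>i. i < n_ineq P \<Longrightarrow> ineq_con P z $ i \<le> 0"
    using opt unfolding optimal_solution_def feasible_def by (blast intro: nonpos_vecD)+
  have u: "\<And>i. i < n_ineq P \<Longrightarrow> 0 \<le> snd u $ i"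
    using dual unfolding dual_optimal_def dual_feasible_def by (blast intro: nonneg_vecD)
  have nonpos: "snd u $ i * ineq_con P z $ i \<le> 0" if "i < n_ineq P" for i
    using u feas(3) that by (simp add: mult_nonneg_nonpos)
  have "lagrangian P u z = objective P z + (\<Sum>i<n_ineq P. snd u $ i * ineq_con P z $ i)"
    using feas(2) by (simp add: lagrangian_sum[OF dims])
  then have "0 \<le> (\<Sum>i<n_ineq P. snd u $ i * ineq_con P z $ i)" using bound[OF feas(1)] by simp
  then have "(\<Sum>i<n_ineq P. - (snd u $ i * ineq_con P z $ i)) \<le> 0" by (simp add: sum_negf)
  moreover have "0 \<le> (\<Sum>i<n_ineq P. - (snd u $ i * ineq_con P z $ i))"
    using nonpos by (intro sum_nonneg) auto
  ultimately have "(\<Sum>i<n_ineq P. - (snd u $ i * ineq_con P z $ i)) = 0" by linarith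
  then show "\<And>i. i < n_ineq P \<Longrightarrow> snd u $ i * ineq_con P z $ i = 0"
    using nonpos sum_nonneg_eq_0_iff[of "{..<n_ineq P}" "\<lambda>i. - (snd u $ i * ineq_con P z $ i)"]
    by simp
qed

section \<open>The constraints in terms of the local variables\<close>

lemma vec_blocks:
  "dim_vec (vRe n z) = n" "dim_vec (vIm n z) = n" "dim_vec (ibRe n z) = n - 1"
  "dim_vec (ibIm n z) = n - 1" "dim_vec (pb n z) = n - 1" "dim_vec (qb n z) = n - 1"
  "r < n \<Longrightarrow> vRe n z $ r = z $ (6 + r)"
  "r < n \<Longrightarrow> vIm n z $ r = z $ (6 + n + r)"
  "r < n - 1 \<Longrightarrow> ibRe n z $ r = z $ (6 + 2 * n + r)"
  "r < n - 1 \<Longrightarrow> ibIm n z $ r = z $ (6 + 2 * n + (n - 1) + r)"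
  "r < n - 1 \<Longrightarrow> pb n z $ r = z $ (6 + 2 * n + 2 * (n - 1) + r)"
  "r < n - 1 \<Longrightarrow> qb n z $ r = z $ (6 + 2 * n + 3 * (n - 1) + r)"
  by (simp_all add: vRe_def vIm_def ibRe_def ibIm_def pb_def qb_def block_def)

lemma zdim_cases:
  assumes "i < zdim n"
  obtains "i = 0" | "i = 1" | "i = 2" | "i = 3" | "i = 4" | "i = 5"
    | r where "r < n" "i = 6 + r"
    | r where "r < n" "i = 6 + n + r"
    | r where "r < n - 1" "i = 6 + 2 * n + r"
    | r where "r < n - 1" "i = 6 + 2 * n + (n - 1) + r"
    | r where "r < n - 1" "i = 6 + 2 * n + 2 * (n - 1) + r"
    | r where "r < n - 1" "i = 6 + 2 * n + 3 * (n - 1) + r"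
proof -
  define m where "m = n - 1"
  have i: "i < 6 + 2 * n + 4 * m" using assms by (simp add: zdim_def m_def)
  consider "i < 6" | "6 \<le> i" "i < 6 + n" | "6 + n \<le> i" "i < 6 + 2 * n"
    | "6 + 2 * n \<le> i" "i < 6 + 2 * n + m" | "6 + 2 * n + m \<le> i" "i < 6 + 2 * n + 2 * m"
    | "6 + 2 * n + 2 * m \<le> i" "i < 6 + 2 * n + 3 * m"
    | "6 + 2 * n + 3 * m \<le> i" "i < 6 + 2 * n + 4 * m"
    using i by linarith
  then show ?thesis
  proof cases
    case 1
    then consider "i = 0" | "i = 1" | "i = 2" | "i = 3" | "i = 4" | "i = 5" by linarith
    then show ?thesis using that(1-6) by cases auto
  next
    case 2 then show ?thesis using that(7)[of "i - 6"] by simp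
  next
    case 3 then show ?thesis using that(8)[of "i - (6 + n)"] by simp
  next
    case 4 then show ?thesis using that(9)[of "i - (6 + 2 * n)"] by (simp add: m_def)
  next
    case 5 then show ?thesis using that(10)[of "i - (6 + 2 * n + m)"]
      unfolding m_def[symmetric] by simp
  next
    case 6 then show ?thesis using that(11)[of "i - (6 + 2 * n + 2 * m)"]
      unfolding m_def[symmetric] by simp
  next
    case 7 then show ?thesis using that(12)[of "i - (6 + 2 * n + 3 * m)"]
      unfolding m_def[symmetric] by simp
  qed
qed

lemma two_blocks_cases:
  fixes i c m :: nat
  assumes "i < c + 2 * m"
  obtains "i < c" | r where "r < m" "i = c + r" | r where "r < m" "i = c + m + r"
proof -
  consider "i < c" | "c \<le> i" "i < c + m" | "c + m \<le> i" by linarith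
  then show ?thesis
    using that(1) that(2)[of "i - c"] that(3)[of "i - (c + m)"] assms by cases auto
qed

lemma double_block_cases:
  fixes i m :: nat
  assumes "i < 2 * m"
  obtains r where "r < m" "i = r" | r where "r < m" "i = m + r"
  using assms that(1)[of i] that(2)[of "i - m"] by (cases "i < m") auto

lemma append_blocks_index:
  assumes "dim_vec A = c" "dim_vec B = m" "dim_vec C = l"
  shows "i < c \<Longrightarrow> (A @\<^sub>v B @\<^sub>v C) $ i = A $ i"
    and "r < m \<Longrightarrow> (A @\<^sub>v B @\<^sub>v C) $ (c + r) = B $ r"
    and "r < l \<Longrightarrow> (A @\<^sub>v B @\<^sub>v C) $ (c + m + r) = C $ r"
  using assms by simp_all

lemma append_two_index:
  assumes "dim_vec A = m" "dim_vec B = m" "r < m"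
  shows "(A @\<^sub>v B) $ r = A $ r" "(A @\<^sub>v B) $ (m + r) = B $ r"
  using assms by simp_all

lemma coord_affine:
  assumes "0 < n"
  shows "affine_fun (zdim n) pG" "affine_fun (zdim n) qG" "affine_fun (zdim n) p_inj"
    "affine_fun (zdim n) q_inj" "affine_fun (zdim n) iRe" "affine_fun (zdim n) iIm"
    "r < n \<Longrightarrow> affine_fun (zdim n) (\<lambda>z. vRe n z $ r)"
    "r < n \<Longrightarrow> affine_fun (zdim n) (\<lambda>z. vIm n z $ r)"
    "r < n - 1 \<Longrightarrow> affine_fun (zdim n) (\<lambda>z. ibRe n z $ r)"
    "r < n - 1 \<Longrightarrow> affine_fun (zdim n) (\<lambda>z. ibIm n z $ r)"
    "r < n - 1 \<Longrightarrow> affine_fun (zdim n) (\<lambda>z. pb n z $ r)"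
    "r < n - 1 \<Longrightarrow> affine_fun (zdim n) (\<lambda>z. qb n z $ r)"
  unfolding pG_def[abs_def] qG_def[abs_def] p_inj_def[abs_def] q_inj_def[abs_def]
    iRe_def[abs_def] iIm_def[abs_def]
  by (simp_all only: vec_blocks) (rule affine_fun_coord, use assms in \<open>simp add: zdim_def\<close>)+

lemma affine_fun_scalar_prod:
  assumes "\<And>z. dim_vec (V z) = n" "\<And>j. j < n \<Longrightarrow> affine_fun d (\<lambda>z. V z $ j)"
  shows "affine_fun d (\<lambda>z. g \<bullet> V z)"
  unfolding scalar_prod_def assms(1) using assms(2)
  by (intro affine_fun_sum affine_fun_cmult) simp

lemma affine_fun_mult_mat_vec:
  assumes "r < dim_row A" "\<And>z. dim_vec (V z) = n" "\<And>j. j < n \<Longrightarrow> affine_fun d (\<lambda>z. V z $ j)"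
  shows "affine_fun d (\<lambda>z. (A *\<^sub>v V z) $ r)"
  using assms(1) affine_fun_scalar_prod[OF assms(2,3)] by simp

lemma CD_dims:
  "dim_row (C_mat net k) = nk net k - 1" "dim_row (D_mat net k) = nk net k - 1"
  by (simp_all add: C_mat_def D_mat_def diff_mat_def g_vec_def b_vec_def)

lemma alpha_con_index:
  fixes net k z
  defines "n \<equiv> nk net k"
  shows "alpha_con net k z $ 0 = iRe z - (g_vec net k \<bullet> vRe n z - b_vec net k \<bullet> vIm n z)"
    and "alpha_con net k z $ 1 = iIm z - (b_vec net k \<bullet> vRe n z + g_vec net k \<bullet> vIm n z)"
    and "alpha_con net k z $ 2 = p_inj z - (pG z - pD net k)"
    and "alpha_con net k z $ 3 = q_inj z - (qG z - qD net k)"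
    and "r < n - 1 \<Longrightarrow> alpha_con net k z $ (4 + r) =
      ibRe n z $ r - ((C_mat net k *\<^sub>v vRe n z) $ r + (D_mat net k *\<^sub>v vIm n z) $ r)"
    and "r < n - 1 \<Longrightarrow> alpha_con net k z $ (4 + (n - 1) + r) =
      ibIm n z $ r - ((D_mat net k *\<^sub>v vRe n z) $ r - (C_mat net k *\<^sub>v vIm n z) $ r)"
  unfolding alpha_con_def Let_def n_def
  by (subst append_blocks_index[of _ 4 _ "nk net k - 1" _ "nk net k - 1"];
    simp add: vec_of_list_index vec_blocks(1-6) CD_dims
      del: vec_of_list_Cons vec_of_list_Nil index_mult_mat_vec)+

lemma lambda_con_index:
  fixes net k z
  defines "n \<equiv> nk net k"
  shows "lambda_con net k z $ 0 = p_inj z - vRe n z $ 0 * iRe z - vIm n z $ 0 * iIm z"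
    and "lambda_con net k z $ 1 = q_inj z - vIm n z $ 0 * iRe z + vRe n z $ 0 * iIm z"
  unfolding lambda_con_def Let_def n_def
  by (simp_all add: vec_of_list_index del: vec_of_list_Cons vec_of_list_Nil)

lemma mu_con_index:
  fixes net k z
  defines "n \<equiv> nk net k"
  assumes "r < n - 1"
  shows "mu_con net k z $ r = pb n z $ r - vRe n z $ 0 * ibRe n z $ r - vIm n z $ 0 * ibIm n z $ r"
    and "mu_con net k z $ ((n - 1) + r) =
      qb n z $ r - vIm n z $ 0 * ibRe n z $ r + vRe n z $ 0 * ibIm n z $ r"
  using assms(2) unfolding mu_con_def Let_def n_def
  by (subst append_two_index[of _ "nk net k - 1"]; simp add: vec_blocks(1-6))+

lemma beta_con_index:
  fixes net k z
  defines "n \<equiv> nk net k"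
  assumes "pbar_max net k \<in> carrier_vec (n - 1)"
  shows "beta_con net k z $ 0 = pGmin net k - pG z" "beta_con net k z $ 1 = pG z - pGmax net k"
    and "beta_con net k z $ 2 = qGmin net k - qG z" "beta_con net k z $ 3 = qG z - qGmax net k"
    and "r < n - 1 \<Longrightarrow> beta_con net k z $ (4 + r) = - pbar_max net k $ r - pb n z $ r"
    and "r < n - 1 \<Longrightarrow> beta_con net k z $ (4 + (n - 1) + r) = pb n z $ r - pbar_max net k $ r"
  using assms(2) unfolding beta_con_def Let_def n_def
  by (subst append_blocks_index[of _ 4 _ "nk net k - 1" _ "nk net k - 1"];
    simp add: vec_of_list_index vec_blocks(1-6)
      del: vec_of_list_Cons vec_of_list_Nil)+

lemma gamma_con_index:
  fixes net k z
  defines "n \<equiv> nk net k"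
  assumes "r < n - 1"
  shows "gamma_con net k z $ r = (ibRe n z $ r)\<^sup>2 + (ibIm n z $ r)\<^sup>2 - (ibar_max net k $ r)\<^sup>2"
    and "gamma_con net k z $ ((n - 1) + r) = (pb n z $ r)\<^sup>2 + (qb n z $ r)\<^sup>2 - (sbar_max net k $ r)\<^sup>2"
  using assms(2) unfolding gamma_con_def Let_def n_def
  by (subst append_two_index[of _ "nk net k - 1"]; simp)+

lemma alpha_con_affine:
  assumes "0 < nk net k" "i < 4 + 2 * (nk net k - 1)"
  shows "affine_fun (zdim (nk net k)) (\<lambda>z. alpha_con net k z $ i)"
  using assms(2)
proof (cases rule: two_blocks_cases)
  case 1
  then consider "i = 0" | "i = 1" | "i = 2" | "i = 3" by linarith
  then show ?thesis
    by cases (simp_all only: alpha_con_index,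
      (intro affine_fun_diff affine_fun_add affine_fun_const affine_fun_scalar_prod[of _ "nk net k"]
        coord_affine assms(1) vec_blocks; assumption?)+)
next
  case (2 r)
  then show ?thesis
    by (simp only: alpha_con_index)
      (intro affine_fun_diff affine_fun_add affine_fun_mult_mat_vec[of _ _ _ "nk net k"]
        coord_affine assms(1) vec_blocks; simp add: CD_dims)
next
  case (3 r)
  then show ?thesis
    by (simp only: alpha_con_index)
      (intro affine_fun_diff affine_fun_add affine_fun_mult_mat_vec[of _ _ _ "nk net k"]
        coord_affine assms(1) vec_blocks; simp add: CD_dims)
qed

text \<open>Voltages are multiplied by currents only, never by themselves or by other voltages.\<close>
lemma lambda_con_multiaffine:
  assumes "0 < nk net k" "i < 2"
  shows "multiaffine (zdim (nk net k)) (\<lambda>z. lambda_con net k z $ i)"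
proof -
  consider "i = 0" | "i = 1" using assms(2) by linarith
  then show ?thesis
    by cases (simp_all only: lambda_con_index vec_blocks(7,8)[OF assms(1)] p_inj_def q_inj_def
        iRe_def iIm_def,
      (intro multiaffine_diff multiaffine_add multiaffine_coord_mult
        multiaffine_affine[OF affine_fun_coord]; use assms(1) in \<open>simp add: zdim_def\<close>)+)
qed

lemma mu_con_multiaffine:
  assumes "0 < nk net k" "i < 2 * (nk net k - 1)"
  shows "multiaffine (zdim (nk net k)) (\<lambda>z. mu_con net k z $ i)"
  using assms(2)
proof (cases rule: double_block_cases)
  case (1 r)
  then show ?thesis
    by (simp only: mu_con_index vec_blocks(7-12) assms(1))
      (intro multiaffine_diff multiaffine_add multiaffine_coord_mult
        multiaffine_affine[OF affine_fun_coord]; use assms(1) in \<open>simp add: zdim_def\<close>)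
next
  case (2 r)
  then show ?thesis
    by (simp only: mu_con_index vec_blocks(7-12) assms(1))
      (intro multiaffine_diff multiaffine_add multiaffine_coord_mult
        multiaffine_affine[OF affine_fun_coord]; use assms(1) in \<open>simp add: zdim_def\<close>)
qed

lemma local_cost_smooth_convex:
  assumes "0 < nk net k" "0 \<le> \<rho>" "convex_on UNIV (cost net k)"
    "\<And>x. cost net k differentiable (at x)"
  shows "smooth_convex (zdim (nk net k)) (local_cost net \<rho> k v y)"
proof -
  define n where "n = nk net k"
  define w where "w = (\<lambda>z. v_loc n z - Ebar_mat net k *\<^sub>v v)"
  have dim: "dim_vec (w z) = 2 * n" for z
    by (simp add: w_def Ebar_mat_def E_mat_def n_def)
  have w: "affine_fun (zdim n) (\<lambda>z. w z $ i)" if "i < 2 * n" for i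
  proof -
    have "w z $ i = v_loc n z $ i - (Ebar_mat net k *\<^sub>v v) $ i" for z
      using that dim[of z] unfolding w_def by simp
    moreover have "affine_fun (zdim n) (\<lambda>z. v_loc n z $ i)"
    proof (cases "i < n")
      case True
      then have "(\<lambda>z. v_loc n z $ i) = (\<lambda>z. vRe n z $ i)"
        by (simp add: v_loc_def vec_blocks(1-6))
      then show ?thesis using coord_affine(7)[OF _ True] assms(1) by (simp add: n_def)
    next
      case False
      then have "(\<lambda>z. v_loc n z $ i) = (\<lambda>z. vIm n z $ (i - n))"
        using that by (simp add: v_loc_def vec_blocks(1-6))
      moreover have "i - n < n" using False that by simp
      ultimately show ?thesis using coord_affine(8)[of n "i - n"] assms(1) by (simp add: n_def)
    qed
    ultimately show ?thesis by (simp add: affine_fun_diff affine_fun_const)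
  qed
  have ww: "w z \<bullet> w z = (\<Sum>i\<in>{0..<2 * n}. (w z $ i)\<^sup>2)" for z
    by (simp only: scalar_prod_def dim power2_eq_square)
  have "local_cost net \<rho> k v y
      = (\<lambda>z. (cost net k (pG z) + y \<bullet> w z) + \<rho> / 2 * (\<Sum>i\<in>{0..<2 * n}. (w z $ i)\<^sup>2))"
    unfolding ww[symmetric] by (simp add: local_cost_def Let_def w_def n_def fun_eq_iff)
  moreover have "smooth_convex (zdim n) \<dots>"
    using assms w dim coord_affine(1)[of n]
    by (intro smooth_convex_add smooth_convex_cmult smooth_convex_sum smooth_convex_square
        smooth_convex_compose[of _ pG "cost net k"] smooth_convex_affine
        affine_fun_scalar_prod[of w "2 * n"]) (auto simp: n_def)
  ultimately show ?thesis by (simp add: n_def)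
qed

lemma three_blocks_cases:
  fixes i a b c :: nat
  assumes "i < a + b + c"
  obtains "i < a" | r where "r < b" "i = a + r" | r where "r < c" "i = a + b + r"
proof -
  consider "i < a" | "a \<le> i" "i < a + b" | "a + b \<le> i" by linarith
  then show ?thesis
    using that(1) that(2)[of "i - a"] that(3)[of "i - (a + b)"] assms by cases auto
qed

lemma four_blocks_cases:
  fixes i a b c d :: nat
  assumes "i < a + b + c + d"
  obtains "i < a" | r where "r < b" "i = a + r" | r where "r < c" "i = a + b + r"
    | r where "r < d" "i = a + b + c + r"
proof -
  consider "i < a + b + c" | "a + b + c \<le> i" by linarith
  then show ?thesis
  proof cases
    case 1
    then show ?thesis by (rule three_blocks_cases) (use that in blast)+
  next
    case 2
    then show ?thesis using that(4)[of "i - (a + b + c)"] assms by auto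
  qed
qed

lemma append_four_blocks_index:
  assumes "dim_vec A = a" "dim_vec B = b" "dim_vec C = c" "dim_vec D = d"
  shows "i < a \<Longrightarrow> (A @\<^sub>v B @\<^sub>v C @\<^sub>v D) $ i = A $ i"
    and "r < b \<Longrightarrow> (A @\<^sub>v B @\<^sub>v C @\<^sub>v D) $ (a + r) = B $ r"
    and "r < c \<Longrightarrow> (A @\<^sub>v B @\<^sub>v C @\<^sub>v D) $ (a + b + r) = C $ r"
    and "r < d \<Longrightarrow> (A @\<^sub>v B @\<^sub>v C @\<^sub>v D) $ (a + b + c + r) = D $ r"
  using assms by simp_all

lemma subproblem_simps:
  "n_var (subproblem net \<rho> k v y) = zdim (nk net k)"
  "n_eq (subproblem net \<rho> k v y) = n_eq_con (nk net k)"
  "n_ineq (subproblem net \<rho> k v y) = n_ineq_con (nk net k)"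
  "objective (subproblem net \<rho> k v y) = local_cost net \<rho> k v y"
  "n_var (convex_subproblem net \<rho> k v y a) = zdim (nk net k)"
  "n_eq (convex_subproblem net \<rho> k v y a) = n_eq_con (nk net k)"
  "n_ineq (convex_subproblem net \<rho> k v y a) = n_ineq_con (nk net k)"
  "objective (convex_subproblem net \<rho> k v y a) = local_cost net \<rho> k v y"
  by (simp_all add: subproblem_def convex_subproblem_def Let_def)

lemma dim_taylor1:
  "dim_vec (taylor1 d (lambda_con net k) a z) = 2"
  "dim_vec (taylor1 d (mu_con net k) a z) = 2 * (nk net k - 1)"
  by (simp_all only: taylor1_def dim_vec dim_eq_con)

lemma subproblem_eq_con_index:
  fixes net k
  defines "n \<equiv> nk net k"
  shows "i < 4 + 2 * (n - 1) \<Longrightarrow> eq_con (subproblem net \<rho> k v y) z $ i = alpha_con net k z $ i"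
    and "r < 2 \<Longrightarrow>
      eq_con (subproblem net \<rho> k v y) z $ ((4 + 2 * (n - 1)) + r) = lambda_con net k z $ r"
    and "r < 2 * (n - 1) \<Longrightarrow>
      eq_con (subproblem net \<rho> k v y) z $ ((4 + 2 * (n - 1)) + 2 + r) = mu_con net k z $ r"
  unfolding subproblem_def nlp.simps n_def
  by (rule append_blocks_index[OF dim_eq_con]; assumption)+

lemma convex_subproblem_eq_con_index:
  fixes net k
  defines "n \<equiv> nk net k"
  shows "i < 4 + 2 * (n - 1) \<Longrightarrow>
      eq_con (convex_subproblem net \<rho> k v y a) z $ i = alpha_con net k z $ i"
    and "r < 2 \<Longrightarrow> eq_con (convex_subproblem net \<rho> k v y a) z $ ((4 + 2 * (n - 1)) + r)
      = taylor1 (zdim n) (lambda_con net k) a z $ r"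
    and "r < 2 * (n - 1) \<Longrightarrow>
      eq_con (convex_subproblem net \<rho> k v y a) z $ ((4 + 2 * (n - 1)) + 2 + r)
      = taylor1 (zdim n) (mu_con net k) a z $ r"
  unfolding convex_subproblem_def Let_def nlp.simps n_def
  by (rule append_blocks_index[OF dim_eq_con(1) dim_taylor1]; assumption)+

lemma ineq_con_index:
  fixes net k
  assumes valid: "valid_network net" "k < nbus net"
  defines "n \<equiv> nk net k"
  shows "i < 4 + 2 * (n - 1) \<Longrightarrow> ineq_con (subproblem net \<rho> k v y) z $ i = beta_con net k z $ i"
    and "r < 2 * (n - 1) \<Longrightarrow>
      ineq_con (subproblem net \<rho> k v y) z $ ((4 + 2 * (n - 1)) + r) = gamma_con net k z $ r"
    and "r < n \<Longrightarrow> ineq_con (subproblem net \<rho> k v y) z $ ((4 + 2 * (n - 1)) + 2 * (n - 1) + r)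
      = volt_lower net k z $ r"
    and "r < n \<Longrightarrow>
      ineq_con (subproblem net \<rho> k v y) z $ ((4 + 2 * (n - 1)) + 2 * (n - 1) + n + r)
      = volt_upper net k z $ r"
    and "i < 4 + 2 * (n - 1) \<Longrightarrow>
      ineq_con (convex_subproblem net \<rho> k v y a) z $ i = beta_con net k z $ i"
    and "r < 2 * (n - 1) \<Longrightarrow>
      ineq_con (convex_subproblem net \<rho> k v y a) z $ ((4 + 2 * (n - 1)) + r) = gamma_con net k z $ r"
    and "r < n \<Longrightarrow>
      ineq_con (convex_subproblem net \<rho> k v y a) z $ ((4 + 2 * (n - 1)) + 2 * (n - 1) + r)
      = volt_halfspace net k v z $ r"
    and "r < n \<Longrightarrow>
      ineq_con (convex_subproblem net \<rho> k v y a) z $ ((4 + 2 * (n - 1)) + 2 * (n - 1) + n + r)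
      = volt_upper net k z $ r"
  unfolding subproblem_def convex_subproblem_def Let_def nlp.simps n_def
  by (rule append_four_blocks_index[OF dim_ineq_con(1)[OF valid] dim_ineq_con(2)[OF valid]
        dim_ineq_con(3)[OF valid] dim_ineq_con(4)[OF valid]]
      append_four_blocks_index[OF dim_ineq_con(1)[OF valid] dim_ineq_con(2)[OF valid]
        dim_ineq_con(5)[OF valid] dim_ineq_con(4)[OF valid]]; assumption)+

lemma valid_networkD:
  assumes "valid_network net" "k < nbus net"
  shows "0 < nk net k" "pbar_max net k \<in> carrier_vec (nk net k - 1)"
    "\<And>r. r < nk net k \<Longrightarrow> 0 \<le> vmin net k $ r"
    "convex_on UNIV (cost net k)" "\<And>x. cost net k differentiable (at x)"
proof -
  have 1: "nbrs net k \<noteq> []" "pbar_max net k \<in> carrier_vec (nk net k - 1)"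
    "0\<^sub>v (nk net k) \<le> vmin net k" "convex_on UNIV (cost net k)"
    "\<forall>x. cost net k differentiable (at x)"
    using assms unfolding valid_network_def by blast+
  then show "0 < nk net k" "pbar_max net k \<in> carrier_vec (nk net k - 1)"
    "\<And>r. r < nk net k \<Longrightarrow> 0 \<le> vmin net k $ r"
    "convex_on UNIV (cost net k)" "\<And>x. cost net k differentiable (at x)"
    using nonneg_vecD by (simp_all add: nk_def)
qed

lemma beta_con_affine:
  assumes "0 < nk net k" "pbar_max net k \<in> carrier_vec (nk net k - 1)" "i < 4 + 2 * (nk net k - 1)"
  shows "affine_fun (zdim (nk net k)) (\<lambda>z. beta_con net k z $ i)"
  using assms(3)
proof (cases rule: two_blocks_cases)
  case 1
  then consider "i = 0" | "i = 1" | "i = 2" | "i = 3" by linarith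
  then show ?thesis
    by cases (simp_all only: beta_con_index[OF assms(2)],
      (intro affine_fun_diff affine_fun_const coord_affine assms(1))+)
next
  case (2 r)
  then show ?thesis
    by (simp only: beta_con_index[OF assms(2)])
      (intro affine_fun_diff affine_fun_const coord_affine assms(1); assumption)
next
  case (3 r)
  then show ?thesis
    by (simp only: beta_con_index[OF assms(2)])
      (intro affine_fun_diff affine_fun_const coord_affine assms(1); assumption)
qed

lemma gamma_con_smooth_convex:
  assumes "0 < nk net k" "i < 2 * (nk net k - 1)"
  shows "smooth_convex (zdim (nk net k)) (\<lambda>z. gamma_con net k z $ i)"
  using assms(2)
proof (cases rule: double_block_cases)
  case (1 r)
  then show ?thesis
    by (simp only: gamma_con_index)
      (intro smooth_convex_diff_const smooth_convex_add smooth_convex_square coord_affine assms(1);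
        assumption)
next
  case (2 r)
  then show ?thesis
    by (simp only: gamma_con_index)
      (intro smooth_convex_diff_const smooth_convex_add smooth_convex_square coord_affine assms(1);
        assumption)
qed

lemma volt_upper_smooth_convex:
  assumes "r < nk net k"
  shows "smooth_convex (zdim (nk net k)) (\<lambda>z. volt_upper net k z $ r)"
proof -
  have "smooth_convex (zdim (nk net k))
      (\<lambda>z. (vRe (nk net k) z $ r)\<^sup>2 + (vIm (nk net k) z $ r)\<^sup>2 - (vmax net k $ r)\<^sup>2)"
    using assms by (intro smooth_convex_diff_const smooth_convex_add smooth_convex_square
        coord_affine) auto
  then show ?thesis using assms by (simp add: volt_upper_def Let_def)
qed

lemma volt_halfspace_affine:
  assumes "r < nk net k"
  shows "affine_fun (zdim (nk net k)) (\<lambda>z. volt_halfspace net k v z $ r)"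
  using assms by (simp only: volt_halfspace_def Let_def index_vec)
    (intro affine_fun_diff affine_fun_add affine_fun_cmult affine_fun_const coord_affine; linarith)

lemma convex_subproblem_eq_con_affine:
  assumes n: "0 < nk net k" and a: "a \<in> carrier_vec (zdim (nk net k))" and i: "i < n_eq_con (nk net k)"
  shows "affine_fun (zdim (nk net k)) (\<lambda>z. eq_con (convex_subproblem net \<rho> k v y a) z $ i)"
  using i[unfolded n_eq_con_def]
proof (cases rule: three_blocks_cases)
  case 1
  then show ?thesis
    by (simp only: convex_subproblem_eq_con_index alpha_con_affine[OF n])
next
  case (2 r)
  then show ?thesis
    by (simp only: convex_subproblem_eq_con_index) (rule affine_fun_taylor1[OF _ a], simp only: dim_eq_con)
next
  case (3 r)
  then show ?thesis
    by (simp only: convex_subproblem_eq_con_index) (rule affine_fun_taylor1[OF _ a], simp only: dim_eq_con)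
qed

lemma convex_subproblem_ineq_con_smooth_convex:
  assumes valid: "valid_network net" "k < nbus net" and i: "i < n_ineq_con (nk net k)"
  shows "smooth_convex (zdim (nk net k)) (\<lambda>z. ineq_con (convex_subproblem net \<rho> k v y a) z $ i)"
  using i[unfolded n_ineq_con_def]
proof (cases rule: four_blocks_cases)
  case 1
  then show ?thesis using smooth_convex_affine[OF beta_con_affine[OF valid_networkD(1,2)[OF valid]]]
    by (simp only: ineq_con_index[OF valid])
next
  case (2 r)
  then show ?thesis using gamma_con_smooth_convex[OF valid_networkD(1)[OF valid]]
    by (simp only: ineq_con_index[OF valid])
next
  case (3 r)
  then show ?thesis using smooth_convex_affine[OF volt_halfspace_affine]
    by (simp only: ineq_con_index[OF valid])
next
  case (4 r)
  then show ?thesis using volt_upper_smooth_convex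
    by (simp only: ineq_con_index[OF valid])
qed


section \<open>Boundedness of the perturbed feasible sets\<close>

definition bounded_fun_on :: "real vec set \<Rightarrow> (real vec \<Rightarrow> real) \<Rightarrow> bool" where
  "bounded_fun_on S F \<longleftrightarrow> (\<exists>R. \<forall>z\<in>S. \<bar>F z\<bar> \<le> R)"

lemma bounded_fun_onI: "(\<And>z. z \<in> S \<Longrightarrow> \<bar>F z\<bar> \<le> R) \<Longrightarrow> bounded_fun_on S F"
  unfolding bounded_fun_on_def by blast

lemma bounded_fun_on_const: "bounded_fun_on S (\<lambda>z. c)"
  by (rule bounded_fun_onI[of _ _ "\<bar>c\<bar>"]) simp

lemma bounded_fun_on_add:
  assumes "bounded_fun_on S F" "bounded_fun_on S G" shows "bounded_fun_on S (\<lambda>z. F z + G z)"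
proof -
  obtain R R' where "\<forall>z\<in>S. \<bar>F z\<bar> \<le> R" "\<forall>z\<in>S. \<bar>G z\<bar> \<le> R'"
    using assms unfolding bounded_fun_on_def by blast
  then show ?thesis by (intro bounded_fun_onI[of _ _ "R + R'"]) (metis abs_triangle_ineq add_mono order_trans)
qed

lemma bounded_fun_on_cmult:
  assumes "bounded_fun_on S F" shows "bounded_fun_on S (\<lambda>z. c * F z)"
proof -
  obtain R where "\<forall>z\<in>S. \<bar>F z\<bar> \<le> R" using assms unfolding bounded_fun_on_def by blast
  then show ?thesis
    by (intro bounded_fun_onI[of _ _ "\<bar>c\<bar> * R"]) (simp add: abs_mult mult_left_mono)
qed

lemma bounded_fun_on_diff:
  assumes "bounded_fun_on S F" "bounded_fun_on S G" shows "bounded_fun_on S (\<lambda>z. F z - G z)"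
  using bounded_fun_on_add[OF assms(1) bounded_fun_on_cmult[OF assms(2), of "- 1"]] by simp

lemma bounded_fun_on_sum:
  assumes "\<And>j. j \<in> A \<Longrightarrow> bounded_fun_on S (F j)" shows "bounded_fun_on S (\<lambda>z. \<Sum>j\<in>A. F j z)"
  using assms
  by (induction A rule: infinite_finite_induct)
    (simp_all add: bounded_fun_on_const bounded_fun_on_add)

lemma bounded_fun_on_scalar_prod:
  assumes "\<And>z. dim_vec (V z) = n" "\<And>j. j < n \<Longrightarrow> bounded_fun_on S (\<lambda>z. V z $ j)"
  shows "bounded_fun_on S (\<lambda>z. g \<bullet> V z)"
  unfolding scalar_prod_def assms(1) using assms(2)
  by (intro bounded_fun_on_sum bounded_fun_on_cmult) simp

lemma bounded_fun_on_mult_mat_vec: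
  assumes "r < dim_row A" "\<And>z. dim_vec (V z) = n" "\<And>j. j < n \<Longrightarrow> bounded_fun_on S (\<lambda>z. V z $ j)"
  shows "bounded_fun_on S (\<lambda>z. (A *\<^sub>v V z) $ r)"
  using assms(1) bounded_fun_on_scalar_prod[OF assms(2,3)] by simp

lemma bounded_fun_on_close:
  assumes "\<And>z. z \<in> S \<Longrightarrow> \<bar>F z - G z\<bar> \<le> M" "bounded_fun_on S G"
  shows "bounded_fun_on S F"
  using bounded_fun_on_add[OF bounded_fun_onI[of S "\<lambda>z. F z - G z" M, OF assms(1)] assms(2)] by simp

lemma abs_le_if_square_le:
  fixes x y :: real assumes "x\<^sup>2 \<le> y" shows "\<bar>x\<bar> \<le> 1 + y"
proof -
  have "(\<bar>x\<bar> - 1)\<^sup>2 = x\<^sup>2 - 2 * \<bar>x\<bar> + 1" by (simp add: power2_diff)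
  then show ?thesis using assms zero_le_power2[of "\<bar>x\<bar> - 1"] by linarith
qed

text \<open>
Bounds propagate along the equations. The generation bounds give \<open>pG\<close> and \<open>qG\<close>, and the affine power
balance gives \<open>p_inj\<close> and \<open>q_inj\<close>. The upper voltage bounds give the voltages, and the affine network
equations give all currents. The flow bounds give \<open>pb\<close>, and the apparent power limits give \<open>qb\<close>.
\<close>
lemma convex_subproblem_bounded:
  assumes valid: "valid_network net" "k < nbus net"
  shows "\<exists>R. \<forall>z\<in>carrier_vec (zdim (nk net k)).
    (\<forall>i<n_eq_con (nk net k). \<bar>eq_con (convex_subproblem net \<rho> k v y a) z $ i\<bar> \<le> M) \<longrightarrow>
    (\<forall>i<n_ineq_con (nk net k). ineq_con (convex_subproblem net \<rho> k v y a) z $ i \<le> M) \<longrightarrow>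
    (\<forall>i<zdim (nk net k). \<bar>z $ i\<bar> \<le> R)"
proof -
  define n where "n = nk net k"
  let ?P = "convex_subproblem net \<rho> k v y a"
  define S where "S = {z \<in> carrier_vec (zdim n). (\<forall>i<n_eq_con n. \<bar>eq_con ?P z $ i\<bar> \<le> M) \<and>
    (\<forall>i<n_ineq_con n. ineq_con ?P z $ i \<le> M)}"
  note vn = valid_networkD[OF valid, folded n_def]
  note alpha_idx = alpha_con_index[where net = net and k = k, folded n_def]
  note beta_idx = beta_con_index[where net = net and k = k, folded n_def, OF vn(2)]
  have alpha: "\<bar>alpha_con net k z $ i\<bar> \<le> M" if "z \<in> S" "i < 4 + 2 * (n - 1)" for z i
  proof -
    have "i < n_eq_con n" using that(2) unfolding n_eq_con_def by linarith
    then show ?thesis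
      using that convex_subproblem_eq_con_index(1)[where net = net and k = k, folded n_def]
      by (auto simp: S_def)
  qed
  note ineq_idx = ineq_con_index(5-8)[OF valid, where \<rho> = \<rho> and v = v and y = y and a = a, folded n_def]
  have beta: "beta_con net k z $ i \<le> M" if "z \<in> S" "i < 4 + 2 * (n - 1)" for z i
  proof -
    have "i < n_ineq_con n" using that(2) unfolding n_ineq_con_def by linarith
    then show ?thesis using that ineq_idx(1)[of i] by (auto simp: S_def)
  qed
  have gamma: "gamma_con net k z $ i \<le> M" if "z \<in> S" "i < 2 * (n - 1)" for z i
  proof -
    have "(4 + 2 * (n - 1)) + i < n_ineq_con n" using that(2) unfolding n_ineq_con_def by linarith
    then show ?thesis using that ineq_idx(2)[of i] by (auto simp: S_def)
  qed
  have upper: "volt_upper net k z $ i \<le> M" if "z \<in> S" "i < n" for z i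
  proof -
    have "(4 + 2 * (n - 1)) + 2 * (n - 1) + n + i < n_ineq_con n"
      using that(2) unfolding n_ineq_con_def by linarith
    then show ?thesis using that ineq_idx(4)[of i] by (auto simp: S_def)
  qed
  have bpG: "bounded_fun_on S pG"
  proof (rule bounded_fun_onI[of _ _ "M + \<bar>pGmin net k\<bar> + \<bar>pGmax net k\<bar>"])
    fix z assume z: "z \<in> S"
    show "\<bar>pG z\<bar> \<le> M + \<bar>pGmin net k\<bar> + \<bar>pGmax net k\<bar>"
      using beta[OF z, of 0] beta[OF z, of 1] unfolding beta_idx(1,2) by linarith
  qed
  have bqG: "bounded_fun_on S qG"
  proof (rule bounded_fun_onI[of _ _ "M + \<bar>qGmin net k\<bar> + \<bar>qGmax net k\<bar>"])
    fix z assume z: "z \<in> S"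
    show "\<bar>qG z\<bar> \<le> M + \<bar>qGmin net k\<bar> + \<bar>qGmax net k\<bar>"
      using beta[OF z, of 2] beta[OF z, of 3] unfolding beta_idx(3,4) by linarith
  qed
  have bp: "bounded_fun_on S p_inj"
    by (rule bounded_fun_on_close[of _ _ "\<lambda>z. pG z - pD net k" M])
      (use alpha[of _ 2] in \<open>simp_all add: alpha_idx(3) bpG bounded_fun_on_diff bounded_fun_on_const\<close>)
  have bq: "bounded_fun_on S q_inj"
    by (rule bounded_fun_on_close[of _ _ "\<lambda>z. qG z - qD net k" M])
      (use alpha[of _ 3] in \<open>simp_all add: alpha_idx(4) bqG bounded_fun_on_diff bounded_fun_on_const\<close>)
  have sq: "(vRe n z $ r)\<^sup>2 \<le> M + (vmax net k $ r)\<^sup>2 \<and> (vIm n z $ r)\<^sup>2 \<le> M + (vmax net k $ r)\<^sup>2"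
    if "z \<in> S" "r < n" for z r
  proof -
    have "(vRe n z $ r)\<^sup>2 + (vIm n z $ r)\<^sup>2 - (vmax net k $ r)\<^sup>2 \<le> M"
      using upper[OF that] that(2) by (simp add: volt_upper_def Let_def n_def)
    then show ?thesis using zero_le_power2[of "vRe n z $ r"] zero_le_power2[of "vIm n z $ r"]
      by linarith
  qed
  have bvRe: "bounded_fun_on S (\<lambda>z. vRe n z $ r)" if "r < n" for r
    using sq that by (intro bounded_fun_onI[of _ _ "1 + (M + (vmax net k $ r)\<^sup>2)"] abs_le_if_square_le) blast
  have bvIm: "bounded_fun_on S (\<lambda>z. vIm n z $ r)" if "r < n" for r
    using sq that by (intro bounded_fun_onI[of _ _ "1 + (M + (vmax net k $ r)\<^sup>2)"] abs_le_if_square_le) blast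
  note bscal = bounded_fun_on_scalar_prod[OF vec_blocks(1) bvRe] bounded_fun_on_scalar_prod[OF vec_blocks(2) bvIm]
  have biRe: "bounded_fun_on S iRe"
    by (rule bounded_fun_on_close[of _ _ "\<lambda>z. g_vec net k \<bullet> vRe n z - b_vec net k \<bullet> vIm n z" M])
      (use alpha[of _ 0] in \<open>simp_all add: alpha_idx(1) bscal bounded_fun_on_diff\<close>)
  have biIm: "bounded_fun_on S iIm"
    by (rule bounded_fun_on_close[of _ _ "\<lambda>z. b_vec net k \<bullet> vRe n z + g_vec net k \<bullet> vIm n z" M])
      (use alpha[of _ 1] in \<open>simp_all add: alpha_idx(2)[unfolded One_nat_def] bscal bounded_fun_on_add\<close>)
  have bmat: "bounded_fun_on S (\<lambda>z. (A *\<^sub>v vRe n z) $ r)" "bounded_fun_on S (\<lambda>z. (A *\<^sub>v vIm n z) $ r)"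
    if "r < dim_row A" for A r
    using bounded_fun_on_mult_mat_vec[OF that vec_blocks(1) bvRe]
      bounded_fun_on_mult_mat_vec[OF that vec_blocks(2) bvIm] by simp_all
  have bibRe: "bounded_fun_on S (\<lambda>z. ibRe n z $ r)" if r: "r < n - 1" for r
  proof (rule bounded_fun_on_close[of _ _
        "\<lambda>z. (C_mat net k *\<^sub>v vRe n z) $ r + (D_mat net k *\<^sub>v vIm n z) $ r" M])
    fix z assume "z \<in> S"
    moreover have "4 + r < 4 + 2 * (n - 1)" using r by linarith
    ultimately show "\<bar>ibRe n z $ r - ((C_mat net k *\<^sub>v vRe n z) $ r + (D_mat net k *\<^sub>v vIm n z) $ r)\<bar> \<le> M"
      using alpha[of z "4 + r"] by (simp only: alpha_idx(5)[OF r])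
  next
    show "bounded_fun_on S (\<lambda>z. (C_mat net k *\<^sub>v vRe n z) $ r + (D_mat net k *\<^sub>v vIm n z) $ r)"
      using r by (intro bounded_fun_on_add bmat) (simp_all only: CD_dims n_def)
  qed
  have bibIm: "bounded_fun_on S (\<lambda>z. ibIm n z $ r)" if r: "r < n - 1" for r
  proof (rule bounded_fun_on_close[of _ _
        "\<lambda>z. (D_mat net k *\<^sub>v vRe n z) $ r - (C_mat net k *\<^sub>v vIm n z) $ r" M])
    fix z assume "z \<in> S"
    moreover have "4 + (n - 1) + r < 4 + 2 * (n - 1)" using r by linarith
    ultimately show "\<bar>ibIm n z $ r - ((D_mat net k *\<^sub>v vRe n z) $ r - (C_mat net k *\<^sub>v vIm n z) $ r)\<bar> \<le> M"
      using alpha[of z "4 + (n - 1) + r"] by (simp only: alpha_idx(6)[OF r])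
  next
    show "bounded_fun_on S (\<lambda>z. (D_mat net k *\<^sub>v vRe n z) $ r - (C_mat net k *\<^sub>v vIm n z) $ r)"
      using r by (intro bounded_fun_on_diff bmat) (simp_all only: CD_dims n_def)
  qed
  have bpb: "bounded_fun_on S (\<lambda>z. pb n z $ r)" if r: "r < n - 1" for r
  proof (rule bounded_fun_onI[of _ _ "M + \<bar>pbar_max net k $ r\<bar>"])
    fix z assume z: "z \<in> S"
    have "4 + r < 4 + 2 * (n - 1)" "4 + (n - 1) + r < 4 + 2 * (n - 1)" using r by linarith+
    then have "- pbar_max net k $ r - pb n z $ r \<le> M" "pb n z $ r - pbar_max net k $ r \<le> M"
      using beta[OF z, of "4 + r"] beta[OF z, of "4 + (n - 1) + r"]
      by (simp_all only: beta_idx(5,6)[OF r])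
    moreover have "(- pbar_max net k) $ r = - (pbar_max net k $ r)" using vn(2) r by simp
    ultimately show "\<bar>pb n z $ r\<bar> \<le> M + \<bar>pbar_max net k $ r\<bar>" by linarith
  qed
  have bqb: "bounded_fun_on S (\<lambda>z. qb n z $ r)" if r: "r < n - 1" for r
  proof (rule bounded_fun_onI[of _ _ "1 + (M + (sbar_max net k $ r)\<^sup>2)"], rule abs_le_if_square_le)
    fix z assume z: "z \<in> S"
    have "(n - 1) + r < 2 * (n - 1)" using r by linarith
    then have "(pb n z $ r)\<^sup>2 + (qb n z $ r)\<^sup>2 - (sbar_max net k $ r)\<^sup>2 \<le> M"
      using gamma[OF z, of "(n - 1) + r"] gamma_con_index(2)[where net = net and k = k, folded n_def, OF r]
      by simp
    then show "(qb n z $ r)\<^sup>2 \<le> M + (sbar_max net k $ r)\<^sup>2"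
      using zero_le_power2[of "pb n z $ r"] by linarith
  qed
  have "bounded_fun_on S (\<lambda>z. z $ i)" if "i < zdim n" for i
    using that
  proof (cases rule: zdim_cases)
    case 1 then show ?thesis using bpG by (simp add: pG_def[abs_def])
  next
    case 2 then show ?thesis using bqG by (simp add: qG_def[abs_def])
  next
    case 3 then show ?thesis using bp by (simp add: p_inj_def[abs_def])
  next
    case 4 then show ?thesis using bq by (simp add: q_inj_def[abs_def])
  next
    case 5 then show ?thesis using biRe by (simp add: iRe_def[abs_def])
  next
    case 6 then show ?thesis using biIm by (simp add: iIm_def[abs_def])
  next
    case (7 r) then show ?thesis using bvRe[of r] by (simp only: vec_blocks)
  next
    case (8 r) then show ?thesis using bvIm[of r] by (simp only: vec_blocks)
  next
    case (9 r) then show ?thesis using bibRe[of r] by (simp only: vec_blocks)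
  next
    case (10 r) then show ?thesis using bibIm[of r] by (simp only: vec_blocks)
  next
    case (11 r) then show ?thesis using bpb[of r] by (simp only: vec_blocks)
  next
    case (12 r) then show ?thesis using bqb[of r] by (simp only: vec_blocks)
  qed
  then obtain R where R: "\<And>i z. i < zdim n \<Longrightarrow> z \<in> S \<Longrightarrow> \<bar>z $ i\<bar> \<le> R i"
    unfolding bounded_fun_on_def by metis
  have "\<bar>z $ i\<bar> \<le> (\<Sum>j<zdim n. \<bar>R j\<bar>)" if "z \<in> S" "i < zdim n" for z i
  proof -
    have "\<bar>z $ i\<bar> \<le> \<bar>R i\<bar>" using R[OF that(2,1)] by linarith
    also have "\<dots> \<le> (\<Sum>j<zdim n. \<bar>R j\<bar>)"
      using that(2) member_le_sum[of i "{..<zdim n}" "\<lambda>j. \<bar>R j\<bar>"] by simp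
    finally show ?thesis .
  qed
  then show ?thesis unfolding S_def n_def by (intro exI[of _ "\<Sum>j<zdim (nk net k). \<bar>R j\<bar>"]) blast
qed

lemma convex_subproblem_bounded_convex:
  assumes valid: "valid_network net" "k < nbus net" and "0 < \<rho>" and a: "a \<in> carrier_vec (zdim (nk net k))"
  shows "bounded_convex_nlp (convex_subproblem net \<rho> k v y a)"
  unfolding bounded_convex_nlp_def subproblem_simps
  using valid_networkD[OF valid] \<open>0 < \<rho>\<close> dim_nlp_con(3,4)[OF valid]
    convex_subproblem_eq_con_affine[OF _ a] convex_subproblem_ineq_con_smooth_convex[OF valid]
    convex_subproblem_bounded[OF valid]
  by (intro conjI allI impI local_cost_smooth_convex) simp_all


section \<open>Passage to the limit\<close>

lemma convex_subproblem_eq_con_tendsto: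
  assumes n: "0 < nk net k" and i: "i < n_eq_con (nk net k)"
    and A: "vec_tendsto A a" "a \<in> carrier_vec (zdim (nk net k))"
    and X: "vec_tendsto X x" "x \<in> carrier_vec (zdim (nk net k))"
  shows "(\<lambda>m. eq_con (convex_subproblem net \<rho> k v y (A m)) (X m) $ i)
    \<longlonglongrightarrow> eq_con (convex_subproblem net \<rho> k v y a) x $ i"
  using i[unfolded n_eq_con_def]
proof (cases rule: three_blocks_cases)
  case 1
  then show ?thesis
    by (simp only: convex_subproblem_eq_con_index)
      (rule coord_continuous_tendsto[OF coord_continuous_affine X], rule alpha_con_affine[OF n])
next
  case (2 r)
  then show ?thesis
    by (simp only: convex_subproblem_eq_con_index)
      (rule taylor1_multiaffine_tendsto[OF lambda_con_multiaffine[OF n] _ A X], simp_all only: dim_eq_con)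
next
  case (3 r)
  then show ?thesis
    by (simp only: convex_subproblem_eq_con_index)
      (rule taylor1_multiaffine_tendsto[OF mu_con_multiaffine[OF n] _ A X], simp_all only: dim_eq_con)
qed

text \<open>
At points that differ from the base point in one coordinate only, the linearized and the
original equations agree. In particular they agree at the base point.
\<close>
lemma convex_subproblem_eq_con_exact:
  assumes n: "0 < nk net k" and i: "i < n_eq_con (nk net k)"
    and a: "a \<in> carrier_vec (zdim (nk net k))" and l: "l < zdim (nk net k)"
  shows "eq_con (convex_subproblem net \<rho> k v y a) (update_vec a l t) $ i
    = eq_con (subproblem net \<rho> k v y) (update_vec a l t) $ i"
  using i[unfolded n_eq_con_def]
proof (cases rule: three_blocks_cases)
  case 1
  then show ?thesis
    by (simp only: convex_subproblem_eq_con_index subproblem_eq_con_index)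
next
  case (2 r)
  then show ?thesis
    by (simp only: convex_subproblem_eq_con_index subproblem_eq_con_index)
      (rule taylor1_multiaffine_update[OF lambda_con_multiaffine[OF n] _ a l], simp_all only: dim_eq_con)
next
  case (3 r)
  then show ?thesis
    by (simp only: convex_subproblem_eq_con_index subproblem_eq_con_index)
      (rule taylor1_multiaffine_update[OF mu_con_multiaffine[OF n] _ a l], simp_all only: dim_eq_con)
qed

lemma volt_lower_nonpos:
  assumes valid: "valid_network net" "k < nbus net"
    and strict: "strictly_in_Xcheck net k v z" and r: "r < nk net k"
  shows "volt_lower net k z $ r \<le> 0"
proof -
  let ?x = "vRe (nk net k) z $ r" and ?y = "vIm (nk net k) z $ r"
  have "(?x, ?y) \<in> Xcheck_set (vmin net k $ r) (vmax net k $ r) (vcheckRe net k v $ r) (vcheckIm net k v $ r)"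
    using strict r unfolding strictly_in_Xcheck_def Xcheck_set_iff[OF valid_networkD(3)[OF valid r]]
    by (auto simp: volt_halfspace_def volt_upper_def Let_def dest!: spec[of _ r])
  then have "(vmin net k $ r)\<^sup>2 \<le> ?x\<^sup>2 + ?y\<^sup>2" by (simp add: Xcheck_set_def X_set_def)
  then show ?thesis using r by (simp add: volt_lower_def Let_def)
qed

text \<open>
The limit is taken in the saddle point inequality rather than in the stationarity condition. The
latter would require continuity of the derivative of the cost, whereas the former is an inequality
between continuous expressions for each fixed competitor \<open>w\<close>. Stationarity is recovered afterwards
from minimality along coordinate lines.
\<close>
theorem kkt_of_limit:
  assumes valid: "valid_network net" "k < nbus net" and \<rho>: "0 < \<rho>"
    and alg: "algorithm2 net \<rho> k v y zs us"
    and zlim: "vec_tendsto zs zst"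
    and elim: "vec_tendsto (\<lambda>m. fst (us m)) (fst ust)"
    and ilim: "vec_tendsto (\<lambda>m. snd (us m)) (snd ust)"
    and strict: "strictly_in_Xcheck net k v zst"
  shows "kkt (subproblem net \<rho> k v y) zst ust"
proof -
  define n where "n = nk net k"
  define d where "d = zdim n"
  define Q where "Q = subproblem net \<rho> k v y"
  define P where "P = convex_subproblem net \<rho> k v y"
  note n = valid_networkD(1)[OF valid]
  have Qs: "n_var Q = d" "n_eq Q = n_eq_con n" "n_ineq Q = n_ineq_con n" "objective Q = local_cost net \<rho> k v y"
    by (simp_all add: Q_def d_def n_def subproblem_simps)
  have Ps: "n_var (P a) = d" "n_eq (P a) = n_eq_con n" "n_ineq (P a) = n_ineq_con n"
    "objective (P a) = local_cost net \<rho> k v y" for a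
    by (simp_all add: P_def d_def n_def subproblem_simps)
  have dims: "dim_vec (eq_con Q z) = n_eq_con n" "dim_vec (ineq_con Q z) = n_ineq_con n"
    "dim_vec (eq_con (P a) z) = n_eq_con n" "dim_vec (ineq_con (P a) z) = n_ineq_con n" for a z
    using dim_nlp_con[OF valid] by (simp_all add: Q_def P_def n_def)
  have ineqP: "ineq_con (P a) = ineq_con (P b)" for a b
    by (simp add: P_def convex_subproblem_def Let_def)
  obtain zh where init: "initial_point net k v (zh 1)"
    and step: "\<And>m. 1 \<le> m \<Longrightarrow> optimal_solution (P (zh m)) (zs m)"
      "\<And>m. 1 \<le> m \<Longrightarrow> dual_optimal (P (zh m)) (us m)" "\<And>m. 1 \<le> m \<Longrightarrow> zh (Suc m) = zs m"
    using alg unfolding algorithm2_def P_def by blast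
  have feas: "feasible (P (zh m)) (zs m)" if "1 \<le> m" for m
    using step(1)[OF that] unfolding optimal_solution_def by blast
  have dfeas: "dual_feasible (P (zh m)) (us m)" if "1 \<le> m" for m
    using step(2)[OF that] unfolding dual_optimal_def by blast
  have zs: "zs m \<in> carrier_vec d" if "1 \<le> m" for m
    using feas[OF that] unfolding feasible_def Ps by blast
  have zh: "zh m \<in> carrier_vec d" if m: "1 \<le> m" for m
  proof (cases "m = 1")
    case True
    then show ?thesis using init unfolding initial_point_def Let_def d_def n_def by blast
  next
    case False
    then have "zh (Suc (m - 1)) = zs (m - 1)" "1 \<le> m - 1" using m step(3)[of "m - 1"] by auto
    then show ?thesis using zs[of "m - 1"] m by simp
  qed
  have zst: "zst \<in> carrier_vec d" using vec_tendsto_carrier[OF zlim zs] .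
  have fst_ust: "fst ust \<in> carrier_vec (n_eq_con n)"
    using vec_tendsto_carrier[OF elim] dfeas unfolding dual_feasible_def Ps by blast
  have snd_ust: "snd ust \<in> carrier_vec (n_ineq_con n)"
    using vec_tendsto_carrier[OF ilim] dfeas unfolding dual_feasible_def Ps by blast
  note ei = vec_tendstoD(2)[OF elim fst_ust] and ii = vec_tendstoD(2)[OF ilim snd_ust]
  have zhlim: "vec_tendsto zh zst"
  proof -
    have ev: "\<forall>\<^sub>F m in sequentially. zh (Suc m) = zs m"
      using eventually_ge_at_top[of 1] by eventually_elim (rule step(3))
    have "vec_tendsto (\<lambda>m. zh (Suc m)) zst"
    proof (rule vec_tendstoI[OF zst])
      show "\<forall>\<^sub>F m in sequentially. zh (Suc m) \<in> carrier_vec d"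
        using ev vec_tendstoD(1)[OF zlim zst] by eventually_elim simp
      fix i assume "i < d"
      moreover have "\<forall>\<^sub>F m in sequentially. zh (Suc m) $ i = zs m $ i"
        using ev by eventually_elim simp
      ultimately show "(\<lambda>m. zh (Suc m) $ i) \<longlonglongrightarrow> zst $ i"
        using vec_tendstoD(2)[OF zlim zst] by (simp add: tendsto_cong)
    qed
    then show ?thesis by (simp add: vec_tendsto_Suc_iff)
  qed
  have bc: "bounded_convex_nlp (P a)" if "a \<in> carrier_vec d" for a
    using convex_subproblem_bounded_convex[OF valid \<rho>] that unfolding P_def d_def n_def by blast
  have eq_lim: "(\<lambda>m. eq_con (P (zh m)) (X m) $ i) \<longlonglongrightarrow> eq_con (P zst) x $ i"
    if "i < n_eq_con n" "vec_tendsto X x" "x \<in> carrier_vec d" for X x i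
    using convex_subproblem_eq_con_tendsto[OF n _ zhlim _ that(2)] that zst
    unfolding P_def d_def n_def by blast
  have ineq_cont: "coord_continuous d (\<lambda>z. ineq_con (P zst) z $ i)" if "i < n_ineq_con n" for i
    using bc[OF zst] that smooth_convexD(1) unfolding bounded_convex_nlp_def Ps by blast
  have eq_exact: "eq_con (P zst) (update_vec zst l t) $ i = eq_con Q (update_vec zst l t) $ i"
    if "l < d" "i < n_eq_con n" for l t i
    using convex_subproblem_eq_con_exact[OF n] that zst unfolding P_def Q_def d_def n_def by blast
  have upd_id: "update_vec zst l (zst $ l) = zst" for l
    by (intro eq_vecI) (auto simp: update_vec_def)
  have "0 < d" by (simp add: d_def zdim_def)

  have eq0: "eq_con (P zst) zst $ i = 0" if i: "i < n_eq_con n" for i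
  proof -
    have "\<forall>\<^sub>F m in sequentially. eq_con (P (zh m)) (zs m) $ i = 0"
      using eventually_ge_at_top[of 1]
      by eventually_elim (use feas i in \<open>simp add: feasible_def Ps\<close>)
    then have "(\<lambda>m. eq_con (P (zh m)) (zs m) $ i) \<longlonglongrightarrow> 0" by (rule tendsto_eventually)
    then show ?thesis using eq_lim[OF i zlim zst] LIMSEQ_unique by blast
  qed
  \<comment> \<open>The limit point lies on the coordinate line with index 0 through itself.\<close>
  have eqQ0: "eq_con Q zst $ i = 0" if i: "i < n_eq_con n" for i
    using eq_exact[OF \<open>0 < d\<close> i, of "zst $ 0"] eq0[OF i] by (simp add: upd_id)
  have ineq_lim: "(\<lambda>m. ineq_con (P zst) (zs m) $ i) \<longlonglongrightarrow> ineq_con (P zst) zst $ i"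
    if "i < n_ineq_con n" for i
    by (rule coord_continuous_tendsto[OF ineq_cont[OF that] zlim zst])
  have ineq_nonpos: "ineq_con (P zst) zst $ i \<le> 0" if i: "i < n_ineq_con n" for i
  proof (rule tendsto_upperbound[OF ineq_lim[OF i]])
    show "\<forall>\<^sub>F m in sequentially. ineq_con (P zst) (zs m) $ i \<le> 0"
      using eventually_ge_at_top[of 1]
    proof eventually_elim
      case (elim m)
      then have "ineq_con (P (zh m)) (zs m) \<le> 0\<^sub>v (n_ineq_con n)"
        using feas unfolding feasible_def Ps by blast
      then show ?case using nonpos_vecD[OF _ i] unfolding ineqP[of zst "zh m"] by blast
    qed
  qed simp
  have dual_nonneg: "0 \<le> snd ust $ i" if i: "i < n_ineq_con n" for i
  proof (rule tendsto_lowerbound[OF ii[OF i]])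
    show "\<forall>\<^sub>F m in sequentially. 0 \<le> snd (us m) $ i"
      using eventually_ge_at_top[of 1]
      by eventually_elim (use dfeas i nonneg_vecD in \<open>unfold dual_feasible_def Ps, blast\<close>)
  qed simp
  have slack: "snd ust $ i * ineq_con (P zst) zst $ i = 0" if i: "i < n_ineq_con n" for i
  proof -
    have "\<forall>\<^sub>F m in sequentially. snd (us m) $ i * ineq_con (P zst) (zs m) $ i = 0"
      using eventually_ge_at_top[of 1]
    proof eventually_elim
      case (elim m)
      show ?case
        using dual_optimal_saddle_point(2)[OF bc[OF zh] step(1,2), of m i] elim i
        unfolding Ps ineqP[of zst "zh m"] by blast
    qed
    then have "(\<lambda>m. snd (us m) $ i * ineq_con (P zst) (zs m) $ i) \<longlonglongrightarrow> 0"
      by (rule tendsto_eventually)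
    then show ?thesis using tendsto_mult[OF ii[OF i] ineq_lim[OF i]] LIMSEQ_unique by blast
  qed

  \<comment> \<open>The two problems differ only in the lower voltage bounds, whose limit multipliers vanish by slackness.\<close>
  have ineq_cases: "snd ust $ i * ineq_con Q w $ i = snd ust $ i * ineq_con (P zst) w $ i
      \<and> ineq_con Q zst $ i \<le> 0" if i: "i < n_ineq_con n" for i w
    using i[unfolded n_ineq_con_def]
  proof (cases rule: four_blocks_cases)
    case 1
    then show ?thesis using ineq_nonpos[OF i] unfolding P_def Q_def n_def
      by (simp only: ineq_con_index[OF valid] simp_thms)
  next
    case (2 r)
    then show ?thesis using ineq_nonpos[OF i] unfolding P_def Q_def n_def
      by (simp only: ineq_con_index[OF valid] simp_thms)
  next
    case (3 r)
    have "ineq_con (P zst) zst $ i < 0"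
      using 3 strict unfolding strictly_in_Xcheck_def P_def n_def
      by (simp only: ineq_con_index[OF valid])
    then have "snd ust $ i = 0" using slack[OF i] by simp
    moreover have "ineq_con Q zst $ i \<le> 0"
      using volt_lower_nonpos[OF valid strict] 3 unfolding Q_def n_def
      by (simp only: ineq_con_index[OF valid])
    ultimately show ?thesis by simp
  next
    case (4 r)
    then show ?thesis using ineq_nonpos[OF i] unfolding P_def Q_def n_def
      by (simp only: ineq_con_index[OF valid] simp_thms)
  qed

  have feasQ: "feasible Q zst"
    unfolding feasible_def Qs less_eq_vec_def using zst dims eqQ0 ineq_cases
    by (auto intro!: eq_vecI)
  have dualP: "dual_feasible (P zst) ust"
    unfolding dual_feasible_def Ps less_eq_vec_def using fst_ust snd_ust dual_nonneg by auto
  then have dualQ: "dual_feasible Q ust" unfolding dual_feasible_def Ps Qs .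

  have lagP: "lagrangian (P a) u w = local_cost net \<rho> k v y w
      + (\<Sum>i<n_eq_con n. fst u $ i * eq_con (P a) w $ i)
      + (\<Sum>i<n_ineq_con n. snd u $ i * ineq_con (P a) w $ i)" for a u w
    using lagrangian_sum[of "P a" w u] by (simp add: Ps dims)
  have lagQ: "lagrangian Q u w = local_cost net \<rho> k v y w
      + (\<Sum>i<n_eq_con n. fst u $ i * eq_con Q w $ i)
      + (\<Sum>i<n_ineq_con n. snd u $ i * ineq_con Q w $ i)" for u w
    using lagrangian_sum[of Q w u] by (simp add: Qs dims)
  have lag_lim: "(\<lambda>m. lagrangian (P (zh m)) (us m) w) \<longlonglongrightarrow> lagrangian (P zst) ust w"
    if w: "w \<in> carrier_vec d" for w
    unfolding lagP ineqP[of "zh _" zst]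
    by (intro tendsto_intros ei ii eq_lim vec_tendsto_const w) auto
  have obj_lim: "(\<lambda>m. local_cost net \<rho> k v y (zs m)) \<longlonglongrightarrow> local_cost net \<rho> k v y zst"
    using bc[OF zst] coord_continuous_tendsto[OF smooth_convexD(1) zlim zst]
    unfolding bounded_convex_nlp_def Ps by blast
  have saddle: "local_cost net \<rho> k v y zst \<le> lagrangian (P zst) ust w" if w: "w \<in> carrier_vec d" for w
  proof (rule tendsto_le[OF sequentially_bot lag_lim[OF w] obj_lim])
    show "\<forall>\<^sub>F m in sequentially. local_cost net \<rho> k v y (zs m) \<le> lagrangian (P (zh m)) (us m) w"
      using eventually_ge_at_top[of 1]
    proof eventually_elim
      case (elim m)
      then show ?case
        using dual_optimal_saddle_point(1)[OF bc[OF zh] step(1,2), of m w] w unfolding Ps by blast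
    qed
  qed
  have lag_zst: "lagrangian (P zst) ust zst = local_cost net \<rho> k v y zst"
  proof -
    have "(\<Sum>i<n_eq_con n. fst ust $ i * eq_con (P zst) zst $ i) = 0"
      "(\<Sum>i<n_ineq_con n. snd ust $ i * ineq_con (P zst) zst $ i) = 0"
      by (intro sum.neutral ballI; simp only: eq0 slack lessThan_iff mult_zero_right)+
    then show ?thesis unfolding lagP by simp
  qed

  \<comment> \<open>Along a coordinate line both Lagrangians are the same function, which has a global minimum at the limit point.\<close>
  have "gradient d (lagrangian Q ust) zst $ i = 0" if i: "i < d" for i
  proof -
    let ?h = "\<lambda>t. lagrangian (P zst) ust (update_vec zst i t)"
    have "(\<lambda>t. lagrangian Q ust (update_vec zst i t)) = ?h"
      unfolding lagP lagQ
      by (intro ext arg_cong2[where f = "(+)"] sum.cong refl;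
        simp only: eq_exact[OF i] ineq_cases[THEN conjunct1] lessThan_iff)
    moreover have "(?h has_real_derivative deriv ?h (zst $ i)) (at (zst $ i))"
      using smooth_convexD(2)[OF lagrangian_smooth_convex[OF bc[OF zst] dualP], unfolded Ps, OF zst i]
        DERIV_deriv_iff_real_differentiable by blast
    moreover have "?h (zst $ i) \<le> ?h t" for t
      using saddle[OF update_vec_carrier[OF zst]] by (simp only: upd_id lag_zst)
    ultimately have "deriv (\<lambda>t. lagrangian Q ust (update_vec zst i t)) (zst $ i) = 0"
      using DERIV_local_min[of ?h "deriv ?h (zst $ i)" "zst $ i" 1] by simp
    then show ?thesis using i by (simp add: gradient_def)
  qed
  then have "gradient d (lagrangian Q ust) zst = 0\<^sub>v d"
    by (intro eq_vecI) (auto simp: gradient_def)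
  moreover have "\<forall>i<n_ineq_con n. snd ust $ i * ineq_con Q zst $ i = 0"
    by (intro allI impI) (simp only: ineq_cases[THEN conjunct1] slack)
  ultimately show ?thesis
    using feasQ dualQ unfolding kkt_def Q_def[symmetric] Qs by blast
qed

theorem proposition1:
  fixes net :: network and \<rho> :: real and v :: "real vec" and y :: "nat \<Rightarrow> real vec"
    and zs :: "nat \<Rightarrow> nat \<Rightarrow> real vec" and us :: "nat \<Rightarrow> nat \<Rightarrow> multipliers"
    and zstar :: "nat \<Rightarrow> real vec" and ustar :: "nat \<Rightarrow> multipliers"
  assumes "valid_network net"
    and "\<rho> > 0"
    and "v \<in> carrier_vec (2 * nbus net)"
    and "\<And>k. k < nbus net \<Longrightarrow> y k \<in> carrier_vec (2 * nk net k)"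
    and "\<And>k. k < nbus net \<Longrightarrow> algorithm2 net \<rho> k v (y k) (zs k) (us k)"
    and "\<And>k. k < nbus net \<Longrightarrow> vec_tendsto (zs k) (zstar k)"
    and "\<And>k. k < nbus net \<Longrightarrow> vec_tendsto (\<lambda>m. fst (us k m)) (fst (ustar k))"
    and "\<And>k. k < nbus net \<Longrightarrow> vec_tendsto (\<lambda>m. snd (us k m)) (snd (ustar k))"
    and "\<And>k. k < nbus net \<Longrightarrow> strictly_in_Xcheck net k v (zstar k)"
  shows "\<forall>k<nbus net. kkt (subproblem net \<rho> k v (y k)) (zstar k) (ustar k)"
  using kkt_of_limit[OF assms(1) _ assms(2)] assms(5-9) by blast

end
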